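(* For every $g\geq 2$ and every integer $k$ with $|k|\leq 2g-2$, there exists a representation $\rho\in R_g$ whose image is a discrete subgroup of $PSL(2,\mathbb{R})$ and whose Euler class is $e(\rho)=k$.
   Context: For $g\ge 2$, $\Gamma_g=\langle a_1,\dots,a_g,b_1,\dots,b_g \mid [a_1,b_1]\cdots[a_g,b_g]\rangle$ and $R_g=\mathrm{Hom}(\Gamma_g,PSL(2,\mathbb{R}))$. Let $\widetilde{PSL(2,\mathbb{R})}\to PSL(2,\mathbb{R})$ be the universal cover; its kernel is infinite cyclic and central, with a generator $z$ fixed by a choice of orientation of $\mathbb{S}^1=\mathbb{R}\cup\{\infty\}$. The Euler class $e:R_g\to\mathbb{Z}$ is defined by $[\widetilde{\rho(a_1)},\widetilde{\rho(b_1)}]\cdots[\widetilde{\rho(a_g)},\widetilde{\rho(b_g)}]=z^{e(\rho)}$, where $\widetilde{\rho(x)}$ is any lift of $\rho(x)$ (the value does not depend on the lifts). *)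

theory Defs
  imports "HOL-Analysis.Analysis" "HOL-Algebra.Coset"
begin

section \<open>Group presentations and surface groups\<close>

text \<open>A word is a list of letters; \<open>(x, True)\<close> stands for the generator \<open>x\<close> and
  \<open>(x, False)\<close> for its formal inverse.\<close>

type_synonym 'a word = "('a \<times> bool) list"

definition words :: "'a set \<Rightarrow> 'a word set" where
  "words S = lists (S \<times> UNIV)"

inductive word_eq :: "'a set \<Rightarrow> 'a word set \<Rightarrow> 'a word \<Rightarrow> 'a word \<Rightarrow> bool"
  for S :: "'a set" and R :: "'a word set" where
  refl: "w \<in> words S \<Longrightarrow> word_eq S R w w"
| sym: "word_eq S R v w \<Longrightarrow> word_eq S R w v"
| trans: "word_eq S R u v \<Longrightarrow> word_eq S R v w \<Longrightarrow> word_eq S R u w"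
| cancel: "u \<in> words S \<Longrightarrow> v \<in> words S \<Longrightarrow> x \<in> S \<Longrightarrow>
    word_eq S R (u @ [(x, b), (x, \<not> b)] @ v) (u @ v)"
| relator: "u \<in> words S \<Longrightarrow> v \<in> words S \<Longrightarrow> r \<in> R \<Longrightarrow> r \<in> words S \<Longrightarrow>
    word_eq S R (u @ r @ v) (u @ v)"

definition word_rel :: "'a set \<Rightarrow> 'a word set \<Rightarrow> 'a word rel" where
  "word_rel S R = {(v, w). word_eq S R v w}"

definition presented_group :: "'a set \<Rightarrow> 'a word set \<Rightarrow> 'a word set monoid" where
  "presented_group S R = \<lparr>carrier = words S // word_rel S R,
     monoid.mult = (\<lambda>X Y. \<Union>x\<in>X. \<Union>y\<in>Y. word_rel S R `` {x @ y}),
     one = word_rel S R `` {[]}\<rparr>"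

definition gen_class :: "'a set \<Rightarrow> 'a word set \<Rightarrow> 'a \<Rightarrow> 'a word set" where
  "gen_class S R x = word_rel S R `` {[(x, True)]}"

datatype surface_gen = GenA nat | GenB nat

definition surface_gens :: "nat \<Rightarrow> surface_gen set" where
  "surface_gens g = GenA ` {..<g} \<union> GenB ` {..<g}"

definition surface_relator :: "nat \<Rightarrow> surface_gen word" where
  "surface_relator g = concat (map (\<lambda>i.
     [(GenA i, True), (GenB i, True), (GenA i, False), (GenB i, False)]) [0..<g])"

text \<open>The generators \<open>a\<^sub>1, \<dots>, a\<^sub>g, b\<^sub>1, \<dots>, b\<^sub>g\<close> are indexed by \<open>0, \<dots>, g - 1\<close>.\<close>

definition surface_group :: "nat \<Rightarrow> surface_gen word set monoid" where
  "surface_group g = presented_group (surface_gens g) {surface_relator g}"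

definition surf_a :: "nat \<Rightarrow> nat \<Rightarrow> surface_gen word set" where
  "surf_a g i = gen_class (surface_gens g) {surface_relator g} (GenA i)"

definition surf_b :: "nat \<Rightarrow> nat \<Rightarrow> surface_gen word set" where
  "surf_b g i = gen_class (surface_gens g) {surface_relator g} (GenB i)"

lemma words_append [simp]: "u @ v \<in> words S \<longleftrightarrow> u \<in> words S \<and> v \<in> words S"
  by (auto simp: words_def)

lemma words_Nil [simp]: "[] \<in> words S"
  by (simp add: words_def)

lemma words_Cons [simp]: "a # w \<in> words S \<longleftrightarrow> fst a \<in> S \<and> w \<in> words S"
  by (cases a) (auto simp: words_def)

lemma word_eq_words: "word_eq S R v w \<Longrightarrow> v \<in> words S \<and> w \<in> words S"
  by (induction rule: word_eq.induct) auto

lemma equiv_word_rel: "equiv (words S) (word_rel S R)"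
proof (rule equivI)
  show "word_rel S R \<subseteq> words S \<times> words S"
    by (auto simp: word_rel_def dest: word_eq_words)
  show "refl_on (words S) (word_rel S R)"
    by (simp add: refl_on_def word_rel_def word_eq.refl)
  show "sym (word_rel S R)"
    unfolding sym_def word_rel_def by (blast intro: word_eq.sym)
  show "trans (word_rel S R)"
    unfolding trans_def word_rel_def by (blast intro: word_eq.trans)
qed

lemma word_eq_append_left:
  "word_eq S R v w \<Longrightarrow> u \<in> words S \<Longrightarrow> word_eq S R (u @ v) (u @ w)"
proof (induction rule: word_eq.induct)
  case (cancel u' v x b)
  then show ?case using word_eq.cancel[of "u @ u'" S v x R b] by simp
next
  case (relator u' v r)
  then show ?case using word_eq.relator[of "u @ u'" S v r R] by simp
qed (auto intro: word_eq.refl word_eq.sym word_eq.trans)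

lemma word_eq_append_right:
  "word_eq S R v w \<Longrightarrow> u \<in> words S \<Longrightarrow> word_eq S R (v @ u) (w @ u)"
proof (induction rule: word_eq.induct)
  case (cancel u' v x b)
  then show ?case using word_eq.cancel[of u' S "v @ u" x R b] by simp
next
  case (relator u' v r)
  then show ?case using word_eq.relator[of u' S "v @ u" r R] by simp
qed (auto intro: word_eq.refl word_eq.sym word_eq.trans)

lemma word_eq_append:
  "word_eq S R u u' \<Longrightarrow> word_eq S R v v' \<Longrightarrow> word_eq S R (u @ v) (u' @ v')"
  by (meson word_eq.trans word_eq_append_left word_eq_append_right word_eq_words)

lemma UN2_const:
  assumes "\<And>x y. x \<in> X \<Longrightarrow> y \<in> Y \<Longrightarrow> F x y = C" "a \<in> X" "b \<in> Y"
  shows "(\<Union>x\<in>X. \<Union>y\<in>Y. F x y) = C"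
proof
  show "(\<Union>x\<in>X. \<Union>y\<in>Y. F x y) \<subseteq> C"
    by (intro UN_least) (simp add: assms(1))
  show "C \<subseteq> (\<Union>x\<in>X. \<Union>y\<in>Y. F x y)"
    using assms(1)[OF assms(2,3)] assms(2,3) by blast
qed

lemma presented_group_mult:
  assumes "u \<in> words S" "v \<in> words S"
  shows "(word_rel S R `` {u}) \<otimes>\<^bsub>presented_group S R\<^esub> (word_rel S R `` {v}) =
    word_rel S R `` {u @ v}"
proof -
  have "word_rel S R `` {x @ y} = word_rel S R `` {u @ v}"
    if "x \<in> word_rel S R `` {u}" "y \<in> word_rel S R `` {v}" for x y
    using that word_eq_append[of S R u x v y]
    by (intro equiv_class_eq[OF equiv_word_rel]) (auto simp: word_rel_def intro: word_eq.sym)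
  moreover have "u \<in> word_rel S R `` {u}" "v \<in> word_rel S R `` {v}"
    using assms by (auto simp: word_rel_def intro: word_eq.refl)
  ultimately show ?thesis
    unfolding presented_group_def monoid.simps partial_object.simps by (rule UN2_const)
qed

lemma presented_group_inverse:
  "w \<in> words S \<Longrightarrow> \<exists>v \<in> words S. word_eq S R (v @ w) []"
proof (induction w)
  case Nil
  then show ?case using word_eq.refl[of "[]" S R] by (intro bexI[of _ "[]"]) auto
next
  case (Cons a w)
  obtain x b where a: "a = (x, b)" by force
  from Cons obtain v where v: "v \<in> words S" "word_eq S R (v @ w) []" by auto
  have "word_eq S R (v @ [(x, \<not> b), (x, \<not> \<not> b)] @ w) (v @ w)"
    using v Cons.prems a by (intro word_eq.cancel) auto
  then have "word_eq S R ((v @ [(x, \<not> b)]) @ a # w) []"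
    using v a by (auto intro: word_eq.trans)
  then show ?case using v Cons.prems a by (intro bexI[of _ "v @ [(x, \<not> b)]"]) auto
qed

lemma group_presented_group: "group (presented_group S R)"
proof (rule groupI)
  let ?G = "presented_group S R"
  have car: "carrier ?G = words S // word_rel S R" and one: "\<one>\<^bsub>?G\<^esub> = word_rel S R `` {[]}"
    by (simp_all add: presented_group_def)
  show "x \<otimes>\<^bsub>?G\<^esub> y \<in> carrier ?G" if "x \<in> carrier ?G" "y \<in> carrier ?G" for x y
    using that unfolding car by (auto elim!: quotientE simp: presented_group_mult intro!: quotientI)
  show "\<one>\<^bsub>?G\<^esub> \<in> carrier ?G" by (simp add: car one quotientI)
  show "x \<otimes>\<^bsub>?G\<^esub> y \<otimes>\<^bsub>?G\<^esub> z = x \<otimes>\<^bsub>?G\<^esub> (y \<otimes>\<^bsub>?G\<^esub> z)"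
    if "x \<in> carrier ?G" "y \<in> carrier ?G" "z \<in> carrier ?G" for x y z
    using that unfolding car by (auto elim!: quotientE simp: presented_group_mult)
  show "\<one>\<^bsub>?G\<^esub> \<otimes>\<^bsub>?G\<^esub> x = x" if "x \<in> carrier ?G" for x
    using that unfolding car one by (auto elim!: quotientE simp: presented_group_mult)
  show "\<exists>y\<in>carrier ?G. y \<otimes>\<^bsub>?G\<^esub> x = \<one>\<^bsub>?G\<^esub>" if "x \<in> carrier ?G" for x
  proof -
    from that obtain w where w: "w \<in> words S" "x = word_rel S R `` {w}"
      unfolding car by (auto elim!: quotientE)
    from presented_group_inverse[OF w(1), of R] obtain v
      where v: "v \<in> words S" "word_eq S R (v @ w) []" by blast
    have "word_rel S R `` {v @ w} = word_rel S R `` {[]}"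
      using v by (intro equiv_class_eq[OF equiv_word_rel]) (simp add: word_rel_def)
    then show ?thesis using v w unfolding car one
      by (intro bexI[of _ "word_rel S R `` {v}"]) (auto simp: presented_group_mult intro!: quotientI)
  qed
qed


section \<open>Topological groups and their universal covers\<close>

definition discrete_subgroup :: "('a, 'b) monoid_scheme \<Rightarrow> 'a topology \<Rightarrow> 'a set \<Rightarrow> bool" where
  "discrete_subgroup G T H \<longleftrightarrow> subgroup H G \<and> subtopology T H = discrete_topology H"

locale topological_group = group G for G :: "('a, 'b) monoid_scheme" (structure) +
  fixes T :: "'a topology"
  assumes topspace_eq: "topspace T = carrier G"
    and continuous_mult: "continuous_map (prod_topology T T) T (\<lambda>(x, y). x \<otimes> y)"
    and continuous_inv: "continuous_map T T (\<lambda>x. inv\<^bsub>G\<^esub> x)"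

text \<open>The universal cover of a topological group \<open>G\<close> is the group of homotopy classes,
  relative to the endpoints, of paths in \<open>G\<close> starting at the identity, multiplied pointwise.
  The covering map sends the class of a path to the endpoint of the path.\<close>

definition based_paths :: "('a, 'b) monoid_scheme \<Rightarrow> 'a topology \<Rightarrow> (real \<Rightarrow> 'a) set" where
  "based_paths G T = {p. pathin T p \<and> p 0 = \<one>\<^bsub>G\<^esub>}"

definition path_homotopy :: "('a, 'b) monoid_scheme \<Rightarrow> 'a topology \<Rightarrow> (real \<Rightarrow> 'a) rel" where
  "path_homotopy G T = {(p, q). p \<in> based_paths G T \<and> q \<in> based_paths G T \<and>
     homotopic_with (\<lambda>h. h 0 = \<one>\<^bsub>G\<^esub> \<and> h 1 = p 1) (top_of_set {0..1}) T p q}"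

definition universal_cover ::
    "('a, 'b) monoid_scheme \<Rightarrow> 'a topology \<Rightarrow> (real \<Rightarrow> 'a) set monoid" where
  "universal_cover G T = \<lparr>carrier = based_paths G T // path_homotopy G T,
     monoid.mult = (\<lambda>X Y. \<Union>p\<in>X. \<Union>q\<in>Y. path_homotopy G T `` {\<lambda>t. p t \<otimes>\<^bsub>G\<^esub> q t}),
     one = path_homotopy G T `` {\<lambda>_. \<one>\<^bsub>G\<^esub>}\<rparr>"

definition cover_map :: "(real \<Rightarrow> 'a) set \<Rightarrow> 'a" where
  "cover_map X = the_elem ((\<lambda>p. p 1) ` X)"

lemma path_homotopy_endpoint:
  assumes "(p, q) \<in> path_homotopy G T" shows "q 1 = p 1"
proof -
  have "homotopic_with (\<lambda>h. h 0 = \<one>\<^bsub>G\<^esub> \<and> h 1 = p 1) (top_of_set {0..1}) T p q"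
    using assms by (simp add: path_homotopy_def)
  from homotopic_with_imp_property[OF this] show ?thesis by simp
qed

lemma equiv_path_homotopy: "equiv (based_paths G T) (path_homotopy G T)"
proof (rule equivI)
  show "path_homotopy G T \<subseteq> based_paths G T \<times> based_paths G T"
    by (auto simp: path_homotopy_def)
  show "refl_on (based_paths G T) (path_homotopy G T)"
    by (auto simp: refl_on_def path_homotopy_def based_paths_def pathin_def)
  show "sym (path_homotopy G T)"
  proof (rule symI)
    fix p q assume pq: "(p, q) \<in> path_homotopy G T"
    then show "(q, p) \<in> path_homotopy G T"
      using path_homotopy_endpoint[OF pq]
      by (simp add: path_homotopy_def homotopic_with_sym)
  qed
  show "trans (path_homotopy G T)"
  proof (rule transI)
    fix p q r assume pq: "(p, q) \<in> path_homotopy G T" and qr: "(q, r) \<in> path_homotopy G T"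
    then show "(p, r) \<in> path_homotopy G T"
      using path_homotopy_endpoint[OF pq]
      by (auto simp: path_homotopy_def intro: homotopic_with_trans)
  qed
qed

lemma cover_map_class:
  assumes "p \<in> based_paths G T"
  shows "cover_map (path_homotopy G T `` {p}) = p 1"
proof -
  have "p \<in> path_homotopy G T `` {p}"
    using assms equiv_class_self[OF equiv_path_homotopy] by blast
  then have "(\<lambda>p. p 1) ` (path_homotopy G T `` {p}) = {p 1}"
    using path_homotopy_endpoint by fastforce
  then show ?thesis by (simp add: cover_map_def)
qed

context topological_group
begin

lemma continuous_map_mult:
  assumes "continuous_map X T f" "continuous_map X T h"
  shows "continuous_map X T (\<lambda>x. f x \<otimes> h x)"
proof -
  have "continuous_map X (prod_topology T T) (\<lambda>x. (f x, h x))"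
    using assms by (simp add: continuous_map_pairwise o_def)
  from continuous_map_compose[OF this continuous_mult] show ?thesis by (simp add: o_def)
qed

lemma based_paths_mult:
  assumes "p \<in> based_paths G T" "q \<in> based_paths G T"
  shows "(\<lambda>t. p t \<otimes> q t) \<in> based_paths G T"
  using assms by (simp add: based_paths_def pathin_def continuous_map_mult)

lemma based_paths_one: "(\<lambda>_. \<one>) \<in> based_paths G T"
  by (simp add: based_paths_def pathin_def topspace_eq)

lemma based_paths_inv:
  assumes "p \<in> based_paths G T"
  shows "(\<lambda>t. inv p t) \<in> based_paths G T"
  using assms by (auto simp: based_paths_def pathin_def
      intro: continuous_map_compose[OF _ continuous_inv, unfolded o_def])

lemma based_paths_carrier:
  assumes "p \<in> based_paths G T" "t \<in> {0..1}"
  shows "p t \<in> carrier G"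
  using assms continuous_map_image_subset_topspace[of "top_of_set {0..1}" T p]
  by (auto simp: based_paths_def pathin_def topspace_eq)

lemma path_homotopy_cong:
  assumes "p \<in> based_paths G T" "\<And>t. t \<in> {0..1} \<Longrightarrow> p t = q t"
  shows "(p, q) \<in> path_homotopy G T"
proof -
  have "continuous_map (top_of_set {0..1}) T q"
    using assms by (auto simp: based_paths_def pathin_def intro: continuous_map_eq)
  moreover have "homotopic_with (\<lambda>h. h 0 = \<one> \<and> h 1 = p 1) (top_of_set {0..1}) T p q"
    using assms by (intro homotopic_with_equal) (auto simp: based_paths_def pathin_def)
  ultimately show ?thesis
    using assms by (auto simp: path_homotopy_def based_paths_def pathin_def)
qed

lemma path_homotopy_mult:
  assumes "(p, p') \<in> path_homotopy G T" "(q, q') \<in> path_homotopy G T"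
  shows "(\<lambda>t. p t \<otimes> q t, \<lambda>t. p' t \<otimes> q' t) \<in> path_homotopy G T"
proof -
  let ?I = "top_of_set {0..1::real}"
  from assms obtain h k where
    h: "continuous_map (prod_topology ?I ?I) T h" "\<And>x. h (0, x) = p x" "\<And>x. h (1, x) = p' x"
      "\<And>t. t \<in> {0..1} \<Longrightarrow> h (t, 0) = \<one> \<and> h (t, 1) = p 1" and
    k: "continuous_map (prod_topology ?I ?I) T k" "\<And>x. k (0, x) = q x" "\<And>x. k (1, x) = q' x"
      "\<And>t. t \<in> {0..1} \<Longrightarrow> k (t, 0) = \<one> \<and> k (t, 1) = q 1"
    unfolding path_homotopy_def homotopic_with_def by (force simp del: atLeastAtMost_iff)
  have "homotopic_with (\<lambda>f. f 0 = \<one> \<and> f 1 = p 1 \<otimes> q 1) ?I T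
      (\<lambda>t. p t \<otimes> q t) (\<lambda>t. p' t \<otimes> q' t)"
    unfolding homotopic_with_def
    using continuous_map_mult[OF h(1) k(1)] h k
    by (intro exI[of _ "\<lambda>x. h x \<otimes> k x"]) auto
  then show ?thesis
    using assms based_paths_mult by (simp add: path_homotopy_def)
qed

lemma universal_cover_mult:
  assumes "p \<in> based_paths G T" "q \<in> based_paths G T"
  shows "(path_homotopy G T `` {p}) \<otimes>\<^bsub>universal_cover G T\<^esub> (path_homotopy G T `` {q}) =
    path_homotopy G T `` {\<lambda>t. p t \<otimes> q t}"
proof -
  have "path_homotopy G T `` {\<lambda>t. x t \<otimes> y t} = path_homotopy G T `` {\<lambda>t. p t \<otimes> q t}"
    if "x \<in> path_homotopy G T `` {p}" "y \<in> path_homotopy G T `` {q}" for x y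
    using that path_homotopy_mult[of p x q y]
    by (intro equiv_class_eq[OF equiv_path_homotopy, symmetric]) auto
  moreover have "p \<in> path_homotopy G T `` {p}" "q \<in> path_homotopy G T `` {q}"
    using assms equiv_class_self[OF equiv_path_homotopy] by blast+
  ultimately show ?thesis
    unfolding universal_cover_def monoid.simps partial_object.simps by (rule UN2_const)
qed

lemma group_universal_cover: "group (universal_cover G T)"
proof (rule groupI)
  let ?U = "universal_cover G T" and ?r = "path_homotopy G T"
  have car: "carrier ?U = based_paths G T // ?r" and one: "\<one>\<^bsub>?U\<^esub> = ?r `` {\<lambda>_. \<one>}"
    by (simp_all add: universal_cover_def)
  note eq = equiv_class_eq[OF equiv_path_homotopy path_homotopy_cong]
  show "x \<otimes>\<^bsub>?U\<^esub> y \<in> carrier ?U" if "x \<in> carrier ?U" "y \<in> carrier ?U" for x y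
    using that unfolding car
    by (auto elim!: quotientE simp: universal_cover_mult based_paths_mult intro!: quotientI)
  show "\<one>\<^bsub>?U\<^esub> \<in> carrier ?U" by (simp add: car one quotientI based_paths_one)
  show "x \<otimes>\<^bsub>?U\<^esub> y \<otimes>\<^bsub>?U\<^esub> z = x \<otimes>\<^bsub>?U\<^esub> (y \<otimes>\<^bsub>?U\<^esub> z)"
    if xyz: "x \<in> carrier ?U" "y \<in> carrier ?U" "z \<in> carrier ?U" for x y z
  proof -
    from xyz obtain p q r where pqr: "p \<in> based_paths G T" "q \<in> based_paths G T" "r \<in> based_paths G T"
      "x = ?r `` {p}" "y = ?r `` {q}" "z = ?r `` {r}"
      unfolding car by (metis quotientE)
    have "?r `` {\<lambda>t. p t \<otimes> q t \<otimes> r t} = ?r `` {\<lambda>t. p t \<otimes> (q t \<otimes> r t)}"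
      using pqr by (intro eq) (auto intro!: based_paths_mult simp: based_paths_carrier m_assoc)
    then show ?thesis using pqr by (simp add: universal_cover_mult based_paths_mult)
  qed
  show "\<one>\<^bsub>?U\<^esub> \<otimes>\<^bsub>?U\<^esub> x = x" if x: "x \<in> carrier ?U" for x
  proof -
    from x obtain p where p: "p \<in> based_paths G T" "x = ?r `` {p}"
      unfolding car by (metis quotientE)
    have "?r `` {\<lambda>t. \<one> \<otimes> p t} = ?r `` {p}"
      using p by (intro eq) (auto intro!: based_paths_mult based_paths_one simp: based_paths_carrier)
    then show ?thesis using p by (simp add: one universal_cover_mult based_paths_one)
  qed
  show "\<exists>y\<in>carrier ?U. y \<otimes>\<^bsub>?U\<^esub> x = \<one>\<^bsub>?U\<^esub>" if "x \<in> carrier ?U" for x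
  proof -
    from that obtain p where p: "p \<in> based_paths G T" "x = ?r `` {p}"
      unfolding car by (auto elim!: quotientE)
    have "?r `` {\<lambda>t. inv p t} \<otimes>\<^bsub>?U\<^esub> x = ?r `` {\<lambda>t. inv p t \<otimes> p t}"
      using p by (simp add: universal_cover_mult based_paths_inv)
    also have "\<dots> = \<one>\<^bsub>?U\<^esub>"
      unfolding one using p
      by (intro eq) (auto simp: based_paths_mult based_paths_inv based_paths_carrier)
    finally show ?thesis
      using p by (intro bexI[of _ "?r `` {\<lambda>t. inv p t}"]) (auto simp: car based_paths_inv intro!: quotientI)
  qed
qed

lemma cover_map_hom: "cover_map \<in> hom (universal_cover G T) G"
proof (rule homI)
  have car: "carrier (universal_cover G T) = based_paths G T // path_homotopy G T"
    by (simp add: universal_cover_def)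
  show "cover_map x \<in> carrier G" if "x \<in> carrier (universal_cover G T)" for x
    using that unfolding car by (auto elim!: quotientE simp: cover_map_class based_paths_carrier)
  show "cover_map (x \<otimes>\<^bsub>universal_cover G T\<^esub> y) = cover_map x \<otimes> cover_map y"
    if "x \<in> carrier (universal_cover G T)" "y \<in> carrier (universal_cover G T)" for x y
    using that unfolding car
    by (auto elim!: quotientE simp: cover_map_class universal_cover_mult based_paths_mult)
qed

end


section \<open>The group \<open>PSL(2,\<real>)\<close>\<close>

definition SL2R :: "(real^2^2) monoid" where
  "SL2R = \<lparr>carrier = {A. det A = 1}, monoid.mult = (**), one = mat 1\<rparr>"

definition PSL2R :: "(real^2^2) set monoid" where
  "PSL2R = SL2R Mod {mat 1, - mat 1}"

definition PSL_proj :: "real^2^2 \<Rightarrow> (real^2^2) set" where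
  "PSL_proj A = {mat 1, - mat 1} #>\<^bsub>SL2R\<^esub> A"

text \<open>The quotient topology induced from \<open>SL(2,\<real>)\<close> as a subspace of the space of matrices.\<close>

definition PSL_topology :: "(real^2^2) set topology" where
  "PSL_topology = topology (\<lambda>V. V \<subseteq> carrier PSL2R \<and>
     openin (top_of_set (carrier SL2R)) {A \<in> carrier SL2R. PSL_proj A \<in> V})"

lemma mult_uminus_mat: "(- mat 1) ** A = - A" "A ** (- mat 1) = - A" for A :: "real^2^2"
proof -
  have "(B + C) ** A = B ** A + C ** A" for B C :: "real^2^2"
    by (simp add: vec_eq_iff matrix_matrix_mult_def sum.distrib distrib_right)
  from this[of "- mat 1" "mat 1"] have "(- mat 1) ** A + mat 1 ** A = 0" by simp
  moreover have "A ** (- mat 1) + A ** mat 1 = 0"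
    using matrix_add_ldistrib[of A "- mat 1" "mat 1"] by simp
  ultimately show "(- mat 1) ** A = - A" "A ** (- mat 1) = - A"
    by (simp_all add: eq_neg_iff_add_eq_0)
qed

lemma PSL_proj_eq: "PSL_proj A = {A, - A}"
  by (auto simp: PSL_proj_def r_coset_def SL2R_def mult_uminus_mat)

lemma carrier_PSL2R: "carrier PSL2R = PSL_proj ` carrier SL2R"
  by (auto simp: PSL2R_def FactGroup_def RCOSETS_def PSL_proj_def)

lemma openin_PSL_topology:
  "openin PSL_topology V \<longleftrightarrow> V \<subseteq> carrier PSL2R \<and>
     openin (top_of_set (carrier SL2R)) {A \<in> carrier SL2R. PSL_proj A \<in> V}"
proof -
  have "istopology (\<lambda>V. V \<subseteq> carrier PSL2R \<and>
     openin (top_of_set (carrier SL2R)) {A \<in> carrier SL2R. PSL_proj A \<in> V})" (is "istopology ?P")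
    unfolding istopology_def
  proof (intro conjI allI impI)
    fix V W assume VW: "?P V" "?P W"
    have "{A \<in> carrier SL2R. PSL_proj A \<in> V \<inter> W} =
      {A \<in> carrier SL2R. PSL_proj A \<in> V} \<inter> {A \<in> carrier SL2R. PSL_proj A \<in> W}" by auto
    with VW show "openin (top_of_set (carrier SL2R)) {A \<in> carrier SL2R. PSL_proj A \<in> V \<inter> W}"
      by (simp add: openin_Int)
    show "V \<inter> W \<subseteq> carrier PSL2R" using VW by auto
  next
    fix K assume K: "\<forall>V\<in>K. ?P V"
    have "{A \<in> carrier SL2R. PSL_proj A \<in> \<Union>K} =
      (\<Union>V\<in>K. {A \<in> carrier SL2R. PSL_proj A \<in> V})" by auto
    with K show "openin (top_of_set (carrier SL2R)) {A \<in> carrier SL2R. PSL_proj A \<in> \<Union>K}"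
      by (auto intro: openin_Union)
    show "\<Union>K \<subseteq> carrier PSL2R" using K by auto
  qed
  then show ?thesis by (simp add: PSL_topology_def topology_inverse')
qed

lemma topspace_PSL_topology: "topspace PSL_topology = carrier PSL2R"
proof -
  have "{A \<in> carrier SL2R. PSL_proj A \<in> carrier PSL2R} = carrier SL2R"
    by (auto simp: carrier_PSL2R)
  then have "openin PSL_topology (carrier PSL2R)"
    by (simp add: openin_PSL_topology)
  then show ?thesis
    using openin_PSL_topology[of "topspace PSL_topology"]
    by (intro subset_antisym openin_subset) simp_all
qed

lemma quotient_map_PSL_proj: "quotient_map (top_of_set (carrier SL2R)) PSL_topology PSL_proj"
  unfolding quotient_map_def topspace_PSL_topology openin_PSL_topology
  by (simp add: carrier_PSL2R)

lemma group_SL2R: "group SL2R"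
proof (rule groupI)
  fix A assume "A \<in> carrier SL2R"
  then have A: "det A = 1" by (simp add: SL2R_def)
  then have "invertible A" by (simp add: invertible_det_nz)
  then obtain B where inv: "B ** A = mat 1" by (auto simp: invertible_def)
  have "det B * det A = det (mat 1 :: real^2^2)" by (simp only: inv flip: det_mul)
  with A inv show "\<exists>B\<in>carrier SL2R. B \<otimes>\<^bsub>SL2R\<^esub> A = \<one>\<^bsub>SL2R\<^esub>"
    by (intro bexI[of _ B]) (simp_all add: SL2R_def)
qed (simp_all add: SL2R_def det_mul matrix_mul_assoc)

lemma normal_center_SL2R: "{mat 1, - mat 1} \<lhd> SL2R"
proof -
  interpret group SL2R by (rule group_SL2R)
  have det: "det (- mat 1 :: real^2^2) = 1" by (simp add: det_2 mat_def)
  have sq: "(- mat 1 :: real^2^2) ** (- mat 1) = mat 1" by (simp add: mult_uminus_mat)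
  have "inv\<^bsub>SL2R\<^esub> (- mat 1) = - mat 1"
    using sq det by (intro inv_equality) (auto simp: SL2R_def)
  moreover have "inv\<^bsub>SL2R\<^esub> (mat 1) = mat 1"
    using inv_one by (simp add: SL2R_def)
  ultimately have "subgroup {mat 1, - mat 1} SL2R"
    using sq det by (intro subgroupI) (auto simp: SL2R_def)
  then show ?thesis
    by (rule normalI) (auto simp: r_coset_def l_coset_def SL2R_def mult_uminus_mat)
qed

lemma group_PSL2R: "group PSL2R"
  unfolding PSL2R_def by (rule normal.factorgroup_is_group[OF normal_center_SL2R])

lemma PSL_proj_mult:
  assumes "A \<in> carrier SL2R" "B \<in> carrier SL2R"
  shows "PSL_proj A \<otimes>\<^bsub>PSL2R\<^esub> PSL_proj B = PSL_proj (A ** B)"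
  using normal.rcos_sum[OF normal_center_SL2R assms]
  by (simp add: PSL2R_def FactGroup_def PSL_proj_def) (simp add: SL2R_def)


lemma PSL_proj_inv:
  assumes "A \<in> carrier SL2R"
  shows "inv\<^bsub>PSL2R\<^esub> (PSL_proj A) = PSL_proj (inv\<^bsub>SL2R\<^esub> A)"
  using normal.inv_FactGroup[OF normal_center_SL2R, of "PSL_proj A"]
    normal.rcos_inv[OF normal_center_SL2R assms] assms carrier_PSL2R
  by (simp add: PSL2R_def PSL_proj_def)

lemma open_map_PSL_proj: "open_map (top_of_set (carrier SL2R)) PSL_topology PSL_proj"
  unfolding open_map_def
proof (intro allI impI)
  fix U assume U: "openin (top_of_set (carrier SL2R)) U"
  then obtain W where W: "open W" "U = carrier SL2R \<inter> W" by (auto simp: openin_open)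
  have neg: "- A \<in> carrier SL2R \<longleftrightarrow> A \<in> carrier SL2R" for A
    by (simp add: SL2R_def det_2)
  have "{A \<in> carrier SL2R. PSL_proj A \<in> PSL_proj ` U} = carrier SL2R \<inter> (W \<union> uminus ` W)"
  proof (intro equalityI subsetI)
    fix A assume "A \<in> {A \<in> carrier SL2R. PSL_proj A \<in> PSL_proj ` U}"
    then obtain B where "A \<in> carrier SL2R" "B \<in> U" "{A, - A} = {B, - B}"
      by (auto simp: PSL_proj_eq)
    then show "A \<in> carrier SL2R \<inter> (W \<union> uminus ` W)"
      using W by (auto simp: doubleton_eq_iff)
  next
    fix A assume "A \<in> carrier SL2R \<inter> (W \<union> uminus ` W)"
    then have A: "A \<in> carrier SL2R" "A \<in> U \<or> - A \<in> U" using W neg by auto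
    have "PSL_proj (- A) = PSL_proj A" by (auto simp: PSL_proj_eq)
    then show "A \<in> {A \<in> carrier SL2R. PSL_proj A \<in> PSL_proj ` U}"
      using A by (metis (mono_tags, lifting) imageI mem_Collect_eq)
  qed
  moreover have "open (W \<union> uminus ` W)" using W by (intro open_Un open_negations) auto
  ultimately show "openin PSL_topology (PSL_proj ` U)"
    using W by (auto simp: openin_PSL_topology carrier_PSL2R openin_open_Int)
qed

lemma continuous_map_PSL_mult:
  "continuous_map (prod_topology PSL_topology PSL_topology) PSL_topology (\<lambda>(x, y). x \<otimes>\<^bsub>PSL2R\<^esub> y)"
proof -
  let ?S = "carrier SL2R" and ?P = "prod_topology PSL_topology PSL_topology"
  interpret SL: group SL2R by (rule group_SL2R)
  interpret PSL: group PSL2R by (rule group_PSL2R)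
  have mult_S: "A ** B \<in> ?S" if "A \<in> ?S" "B \<in> ?S" for A B
    using that by (simp add: SL2R_def det_mul)
  have cont: "continuous_on UNIV (\<lambda>(A :: real^2^2, B :: real^2^2). A ** B)"
    unfolding matrix_matrix_mult_def case_prod_beta by (intro continuous_intros)
  show ?thesis
    unfolding continuous_map
  proof (intro conjI allI impI)
    show "(\<lambda>(x, y). x \<otimes>\<^bsub>PSL2R\<^esub> y) ` topspace ?P \<subseteq> topspace PSL_topology"
      by (auto simp: topspace_PSL_topology)
  next
    fix V assume V: "openin PSL_topology V"
    then obtain W where W: "open W" "{A \<in> ?S. PSL_proj A \<in> V} = ?S \<inter> W"
      by (auto simp: openin_PSL_topology openin_open)
    have "open ((\<lambda>(A :: real^2^2, B :: real^2^2). A ** B) -` W)"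
      by (rule open_vimage[OF W(1) cont])
    show "openin ?P {z \<in> topspace ?P. (case z of (x, y) \<Rightarrow> x \<otimes>\<^bsub>PSL2R\<^esub> y) \<in> V}"
      unfolding openin_prod_topology_alt
    proof (intro allI impI)
      fix x y
      assume "(x, y) \<in> {z \<in> topspace ?P. (case z of (x, y) \<Rightarrow> x \<otimes>\<^bsub>PSL2R\<^esub> y) \<in> V}"
      then obtain A B where AB: "A \<in> ?S" "B \<in> ?S" "x = PSL_proj A" "y = PSL_proj B"
          "PSL_proj (A ** B) \<in> V"
        by (auto simp: topspace_PSL_topology carrier_PSL2R PSL_proj_mult)
      then have "(A, B) \<in> (\<lambda>(A :: real^2^2, B :: real^2^2). A ** B) -` W"
        using W mult_S by auto
      from open_prod_elim[OF \<open>open ((\<lambda>(A :: real^2^2, B :: real^2^2). A ** B) -` W)\<close> this] obtain U1 U2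
        where U: "open U1" "open U2" "A \<in> U1" "B \<in> U2"
          "U1 \<times> U2 \<subseteq> (\<lambda>(A :: real^2^2, B :: real^2^2). A ** B) -` W"
        by (metis mem_Sigma_iff)
      let ?V1 = "PSL_proj ` (?S \<inter> U1)" and ?V2 = "PSL_proj ` (?S \<inter> U2)"
      have "openin PSL_topology ?V1" "openin PSL_topology ?V2"
        using open_map_PSL_proj U by (auto simp: open_map_def openin_open_Int)
      moreover have "?V1 \<times> ?V2 \<subseteq>
          {z \<in> topspace ?P. (case z of (x, y) \<Rightarrow> x \<otimes>\<^bsub>PSL2R\<^esub> y) \<in> V}"
      proof (intro subsetI)
        fix z assume "z \<in> ?V1 \<times> ?V2"
        then obtain A' B' where z: "z = (PSL_proj A', PSL_proj B')"
            "A' \<in> ?S" "A' \<in> U1" "B' \<in> ?S" "B' \<in> U2" by blast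
        then have "A' ** B' \<in> ?S \<inter> W" using U(5) mult_S by auto
        then have "PSL_proj (A' ** B') \<in> V" using W(2) by blast
        then show "z \<in> {z \<in> topspace ?P. (case z of (x, y) \<Rightarrow> x \<otimes>\<^bsub>PSL2R\<^esub> y) \<in> V}"
          using z by (simp add: topspace_PSL_topology carrier_PSL2R PSL_proj_mult)
      qed
      moreover have "x \<in> ?V1" "y \<in> ?V2" using AB U by auto
      ultimately show "\<exists>U V'. openin PSL_topology U \<and> openin PSL_topology V' \<and> x \<in> U \<and> y \<in> V' \<and>
          U \<times> V' \<subseteq> {z \<in> topspace ?P. (case z of (x, y) \<Rightarrow> x \<otimes>\<^bsub>PSL2R\<^esub> y) \<in> V}"
        by (intro exI conjI)
    qed
  qed
qed

lemma SL2R_inv: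
  assumes "A \<in> carrier SL2R"
  shows "inv\<^bsub>SL2R\<^esub> A = vector [vector [A$2$2, - A$1$2], vector [- A$2$1, A$1$1]]"
proof -
  interpret group SL2R by (rule group_SL2R)
  let ?B = "vector [vector [A$2$2, - A$1$2], vector [- A$2$1, A$1$1]] :: real^2^2"
  have A: "A$1$1 * A$2$2 - A$1$2 * A$2$1 = 1" using assms by (simp add: SL2R_def det_2)
  have "?B ** A = mat 1"
    using A by (simp add: vec_eq_iff forall_2 matrix_matrix_mult_def sum_2 mat_def algebra_simps)
  moreover have "?B \<in> carrier SL2R"
    using A by (simp add: SL2R_def det_2 algebra_simps)
  ultimately show ?thesis
    using assms by (intro inv_equality) (simp_all add: SL2R_def)
qed

lemma continuous_map_PSL_inv: "continuous_map PSL_topology PSL_topology (\<lambda>x. inv\<^bsub>PSL2R\<^esub> x)"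
proof -
  interpret group SL2R by (rule group_SL2R)
  let ?S = "carrier SL2R"
  let ?f = "\<lambda>A. vector [vector [A$2$2, - A$1$2], vector [- A$2$1, A$1$1]] :: real^2^2"
  have "continuous_on ?S (\<lambda>A. ?f A $ i $ j)" for i j
    using exhaust_2[of i] exhaust_2[of j] by (elim disjE) (simp_all add: continuous_intros)
  then have "continuous_on ?S (\<lambda>A. \<chi> i j. ?f A $ i $ j)"
    by (intro continuous_on_vec_lambda)
  then have "continuous_on ?S ?f"
    by (simp only: vec_lambda_eta)
  then have "continuous_on ?S (\<lambda>A. inv\<^bsub>SL2R\<^esub> A)"
    by (rule continuous_on_eq) (simp add: SL2R_inv)
  then have "continuous_map (top_of_set ?S) (top_of_set ?S) (\<lambda>A. inv\<^bsub>SL2R\<^esub> A)"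
    by auto
  from continuous_map_compose[OF this quotient_imp_continuous_map[OF quotient_map_PSL_proj]]
  have "continuous_map (top_of_set ?S) PSL_topology ((\<lambda>x. inv\<^bsub>PSL2R\<^esub> x) \<circ> PSL_proj)"
    by (rule continuous_map_eq) (simp add: PSL_proj_inv)
  then show ?thesis
    using continuous_compose_quotient_map_eq[OF quotient_map_PSL_proj] by blast
qed

lemma topological_group_PSL2R: "topological_group PSL2R PSL_topology"
  by (intro topological_group.intro topological_group_axioms.intro group_PSL2R
      topspace_PSL_topology continuous_map_PSL_mult continuous_map_PSL_inv)


section \<open>The Euler class\<close>

text \<open>The matrix of \<open>rotation t\<close> acts on the projective line \<open>\<real> \<union> {\<infinity>}\<close> by
  \<open>x \<mapsto> (x cos t + sin t) / (cos t - x sin t)\<close>. With \<open>\<real>\<close> oriented in the usual way, this moves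
  every point in the positive direction, and goes once around the circle as \<open>t\<close> runs from
  \<open>0\<close> to \<open>\<pi>\<close>. The class of the resulting loop is the positive generator \<open>z\<close> of the kernel
  of the universal cover.\<close>

definition rotation :: "real \<Rightarrow> real^2^2" where
  "rotation t = vector [vector [cos t, sin t], vector [- sin t, cos t]]"

definition PSL_cover :: "(real \<Rightarrow> (real^2^2) set) set monoid" where
  "PSL_cover = universal_cover PSL2R PSL_topology"

definition kernel_gen :: "(real \<Rightarrow> (real^2^2) set) set" where
  "kernel_gen = path_homotopy PSL2R PSL_topology `` {\<lambda>t. PSL_proj (rotation (pi * t))}"

definition commutator :: "('a, 'b) monoid_scheme \<Rightarrow> 'a \<Rightarrow> 'a \<Rightarrow> 'a" where
  "commutator G x y = x \<otimes>\<^bsub>G\<^esub> y \<otimes>\<^bsub>G\<^esub> inv\<^bsub>G\<^esub> x \<otimes>\<^bsub>G\<^esub> inv\<^bsub>G\<^esub> y"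

definition commutator_product ::
    "('a, 'b) monoid_scheme \<Rightarrow> nat \<Rightarrow> (nat \<Rightarrow> 'a) \<Rightarrow> (nat \<Rightarrow> 'a) \<Rightarrow> 'a" where
  "commutator_product G g x y =
     foldr (monoid.mult G) (map (\<lambda>i. commutator G (x i) (y i)) [0..<g]) \<one>\<^bsub>G\<^esub>"

text \<open>The Euler class is the integer \<open>n\<close> such that the equation holds for every choice of lifts.\<close>

definition euler_class :: "nat \<Rightarrow> (surface_gen word set \<Rightarrow> (real^2^2) set) \<Rightarrow> int" where
  "euler_class g \<rho> = (THE n. \<forall>x y.
     (\<forall>i<g. x i \<in> carrier PSL_cover \<and> cover_map (x i) = \<rho> (surf_a g i) \<and>
            y i \<in> carrier PSL_cover \<and> cover_map (y i) = \<rho> (surf_b g i)) \<longrightarrow>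
     commutator_product PSL_cover g x y = kernel_gen [^]\<^bsub>PSL_cover\<^esub> n)"

lemma group_PSL_cover: "group PSL_cover"
  unfolding PSL_cover_def by (rule topological_group.group_universal_cover[OF topological_group_PSL2R])

lemma group_surface_group: "group (surface_group g)"
  unfolding surface_group_def by (rule group_presented_group)

lemma surface_relator_words: "surface_relator g \<in> words (surface_gens g)"
  by (auto simp: surface_relator_def surface_gens_def words_def)

lemma rotation_SL2R: "rotation t \<in> carrier SL2R"
  by (simp add: rotation_def SL2R_def det_2 flip: power2_eq_square)

lemma rotation_0_pi: "rotation 0 = mat 1" "rotation pi = - mat 1"
  by (simp_all add: rotation_def vec_eq_iff mat_def forall_2)

lemma PSL_proj_one: "PSL_proj (mat 1) = \<one>\<^bsub>PSL2R\<^esub>" "PSL_proj (- mat 1) = \<one>\<^bsub>PSL2R\<^esub>"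
  by (auto simp: PSL_proj_eq PSL2R_def FactGroup_def)

lemma rotation_path: "(\<lambda>t. PSL_proj (rotation (pi * t))) \<in> based_paths PSL2R PSL_topology"
proof -
  have "continuous_on {0..1} (\<lambda>t. rotation (pi * t) $ i $ j)" for i j
    using exhaust_2[of i] exhaust_2[of j]
    by (elim disjE) (simp_all add: rotation_def continuous_intros)
  then have "continuous_on {0..1} (\<lambda>t. \<chi> i j. rotation (pi * t) $ i $ j)"
    by (intro continuous_on_vec_lambda)
  then have "continuous_map (top_of_set {0..1}) (top_of_set (carrier SL2R)) (\<lambda>t. rotation (pi * t))"
    by (auto simp: vec_lambda_eta rotation_SL2R)
  from continuous_map_compose[OF this quotient_imp_continuous_map[OF quotient_map_PSL_proj]]
  show ?thesis
    by (simp add: based_paths_def pathin_def o_def rotation_0_pi PSL_proj_one)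
qed

lemma kernel_gen_kernel:
  "kernel_gen \<in> carrier PSL_cover" "cover_map kernel_gen = \<one>\<^bsub>PSL2R\<^esub>"
  using rotation_path
  by (simp_all add: kernel_gen_def PSL_cover_def universal_cover_def quotientI
      cover_map_class rotation_0_pi PSL_proj_one)

end

theory Submission
  imports Defs "HOL-Complex_Analysis.Winding_Numbers"
begin

text \<open>All representations take values in one discrete group, generated by two matrices \<open>p\<close> and \<open>b\<close>
  of determinant 1 with entries in \<open>\<int>[\<surd>7] / 2\<close> whose commutator is a rotation of order 2
  in \<open>PSL(2,\<real>)\<close>; it is discrete because it lies in the union of two quaternionic lattices.
  Lifts of \<open>p\<close> and \<open>b\<close> satisfy \<open>[p,b]\<^sup>2 = z\<close>, and \<open>z\<close> is central. Put
  \<open>c\<^sub>i = p\<^sup>i [p,b] p\<^sup>-\<^sup>i\<close>. Then \<open>c\<^sub>i\<^sup>2 = z\<close> and \<open>[p\<^sup>m,b] = c\<^sub>m\<^sub>-\<^sub>1 \<dots> c\<^sub>0\<close>, while \<open>c\<^sub>i c\<^sub>i\<^sub>+\<^sub>1\<close> is a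
  single commutator. Cancelling the \<open>c\<^sub>i\<close> in pairs writes \<open>z\<^sup>2\<^sup>n\<close> as a product of \<open>n + 1\<close>
  commutators and \<open>z\<^sup>2\<^sup>n\<^sup>+\<^sup>1\<close> as a product of \<open>n + 2\<close> commutators, which is exactly the range
  \<open>k \<le> 2g - 2\<close>; inverses give the negative \<open>k\<close>.\<close>

section \<open>Products of commutators\<close>

definition commutator_products :: "('a, 'b) monoid_scheme \<Rightarrow> 'a set \<Rightarrow> nat \<Rightarrow> 'a set" where
  "commutator_products G H g = {commutator_product G g x y |x y. \<forall>i<g. x i \<in> H \<and> y i \<in> H}"

context group
begin

lemma inv_mult_cancel_left:
  assumes "x \<in> carrier G" "y \<in> carrier G"
  shows "inv x \<otimes> (x \<otimes> y) = y" "x \<otimes> (inv x \<otimes> y) = y"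
  using assms by (simp_all flip: m_assoc)

lemmas group_word_simps = m_assoc inv_mult_group inv_mult_cancel_left

lemma commutator_closed [simp, intro]:
  "x \<in> carrier G \<Longrightarrow> y \<in> carrier G \<Longrightarrow> commutator G x y \<in> carrier G"
  by (simp add: commutator_def)

lemma commutator_one_left: "x \<in> carrier G \<Longrightarrow> commutator G \<one> x = \<one>"
  by (simp add: commutator_def)

lemma inv_commutator:
  "x \<in> carrier G \<Longrightarrow> y \<in> carrier G \<Longrightarrow> inv (commutator G x y) = commutator G y x"
  by (simp add: commutator_def group_word_simps)

lemma foldr_mult_closed: "set xs \<subseteq> carrier G \<Longrightarrow> foldr (\<otimes>) xs \<one> \<in> carrier G"
  by (induction xs) auto

lemma foldr_mult_append:
  assumes "set xs \<subseteq> carrier G" "set ys \<subseteq> carrier G"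
  shows "foldr (\<otimes>) (xs @ ys) \<one> = foldr (\<otimes>) xs \<one> \<otimes> foldr (\<otimes>) ys \<one>"
  using assms by (induction xs) (auto simp: m_assoc foldr_mult_closed)

lemma commutator_product_add:
  assumes "\<And>i. i < m + n \<Longrightarrow> x i \<in> carrier G \<and> y i \<in> carrier G"
  shows "commutator_product G (m + n) x y =
    commutator_product G m x y \<otimes> commutator_product G n (\<lambda>i. x (i + m)) (\<lambda>i. y (i + m))"
proof -
  have "[0..<m + n] = [0..<m] @ map (\<lambda>i. i + m) [0..<n]"
    by (simp add: map_add_upt upt_add_eq_append[of 0] add.commute)
  then have "commutator_product G (m + n) x y =
      foldr (\<otimes>) (map (\<lambda>i. commutator G (x i) (y i)) [0..<m] @
        map (\<lambda>i. commutator G (x (i + m)) (y (i + m))) [0..<n]) \<one>"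
    by (simp only: commutator_product_def map_append map_map o_def)
  also have "\<dots> = commutator_product G m x y \<otimes>
      commutator_product G n (\<lambda>i. x (i + m)) (\<lambda>i. y (i + m))"
    unfolding commutator_product_def using assms by (intro foldr_mult_append) auto
  finally show ?thesis .
qed

lemma commutator_product_closed:
  assumes "\<And>i. i < n \<Longrightarrow> x i \<in> carrier G \<and> y i \<in> carrier G"
  shows "commutator_product G n x y \<in> carrier G"
  unfolding commutator_product_def using assms by (intro foldr_mult_closed) auto

lemma commutator_product_cong:
  assumes "\<And>i. i < n \<Longrightarrow> commutator G (x i) (y i) = commutator G (x' i) (y' i)"
  shows "commutator_product G n x y = commutator_product G n x' y'"
  unfolding commutator_product_def using assms by (intro arg_cong2[where f = "foldr (\<otimes>)"] map_cong refl) auto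

lemma commutator_products_closed:
  assumes "subgroup H G" shows "commutator_products G H n \<subseteq> carrier G"
  unfolding commutator_products_def using subgroup.subset[OF assms]
  by (auto intro!: commutator_product_closed)

lemma one_commutator_products:
  assumes "subgroup H G" shows "\<one> \<in> commutator_products G H n"
proof -
  have "commutator_product G n (\<lambda>_. \<one>) (\<lambda>_. \<one>) = \<one>"
    by (induction n) (simp_all add: commutator_product_def commutator_def)
  then show ?thesis
    unfolding commutator_products_def using subgroup.one_closed[OF assms]
    by (intro CollectI exI[of _ "\<lambda>_. \<one>"]) simp
qed

lemma commutator_in_commutator_products:
  assumes "subgroup H G" "x \<in> H" "y \<in> H"
  shows "commutator G x y \<in> commutator_products G H 1"
proof -
  have "commutator_product G 1 (\<lambda>_. x) (\<lambda>_. y) = commutator G x y"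
    using subgroup.mem_carrier[OF assms(1)] assms by (simp add: commutator_product_def)
  then show ?thesis
    unfolding commutator_products_def using assms
    by (intro CollectI exI[of _ "\<lambda>_. x"] exI[of _ "\<lambda>_. y"]) simp
qed

lemma mult_commutator_products:
  assumes H: "subgroup H G" and "h \<in> commutator_products G H m" "k \<in> commutator_products G H n"
  shows "h \<otimes> k \<in> commutator_products G H (m + n)"
proof -
  obtain x y x' y' where
    xy: "\<And>i. i < m \<Longrightarrow> x i \<in> H \<and> y i \<in> H" "h = commutator_product G m x y" and
    xy': "\<And>i. i < n \<Longrightarrow> x' i \<in> H \<and> y' i \<in> H" "k = commutator_product G n x' y'"
    using assms(2,3) by (auto simp: commutator_products_def)
  define u where "u = (\<lambda>i. if i < m then x i else x' (i - m))"
  define v where "v = (\<lambda>i. if i < m then y i else y' (i - m))"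
  have uv: "u i \<in> H \<and> v i \<in> H" if "i < m + n" for i
    using that xy(1) xy'(1) by (auto simp: u_def v_def)
  then have "commutator_product G (m + n) u v =
      commutator_product G m u v \<otimes> commutator_product G n (\<lambda>i. u (i + m)) (\<lambda>i. v (i + m))"
    by (intro commutator_product_add) (auto intro: subgroup.mem_carrier[OF H])
  also have "commutator_product G m u v = h"
    unfolding xy by (intro commutator_product_cong) (simp add: u_def v_def)
  also have "commutator_product G n (\<lambda>i. u (i + m)) (\<lambda>i. v (i + m)) = k"
    unfolding xy' by (intro commutator_product_cong) (simp add: u_def v_def)
  finally show ?thesis
    unfolding commutator_products_def using uv by (intro CollectI exI[of _ u] exI[of _ v]) simp
qed

text \<open>Pads with \<open>n - m\<close> trivial commutators, so that a product with fewer factors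
  than the genus still counts as a product of \<open>g\<close> commutators.\<close>

lemma commutator_products_mono:
  assumes "subgroup H G" "h \<in> commutator_products G H m" "m \<le> n"
  shows "h \<in> commutator_products G H n"
  using mult_commutator_products[OF assms(1,2) one_commutator_products[OF assms(1), of "n - m"]] assms
    commutator_products_closed[OF assms(1), of m] by (auto simp: subset_iff)

text \<open>Inversion reverses the order of the factors and turns [x,y] into [y,x], so the number of
  factors is kept. This gives the passage from positive to negative Euler class.\<close>

lemma inv_commutator_products:
  assumes H: "subgroup H G" and "h \<in> commutator_products G H n"
  shows "inv h \<in> commutator_products G H n"
proof -
  obtain x y where xy: "\<And>i. i < n \<Longrightarrow> x i \<in> H \<and> y i \<in> H" "h = commutator_product G n x y"
    using assms by (auto simp: commutator_products_def)
  have "inv (commutator_product G n x y) \<in> commutator_products G H n"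
    using xy(1)
  proof (induction n)
    case 0
    then show ?case
      using one_commutator_products[OF H, of 0] by (simp add: commutator_product_def)
  next
    case (Suc n)
    have mem: "x i \<in> carrier G" "y i \<in> carrier G" if "i < Suc n" for i
      using Suc.prems[OF that] by (auto intro: subgroup.mem_carrier[OF H])
    have "inv (commutator_product G (Suc n) x y) =
        commutator G (y n) (x n) \<otimes> inv (commutator_product G n x y)"
      using mem commutator_product_add[of n 1 x y] commutator_product_closed[of n x y]
      by (simp add: commutator_product_def[of G 1] commutator_product_def[of G "Suc 0"] inv_mult_group inv_commutator)
    also have "\<dots> \<in> commutator_products G H (1 + n)"
      using Suc by (intro mult_commutator_products[OF H] commutator_in_commutator_products[OF H]) auto
    finally show ?case by simp
  qed
  then show ?thesis by (simp add: xy)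
qed

section \<open>Commutator identities and powers of a central element\<close>

lemma conj_commutator:
  assumes "q \<in> carrier G" "u \<in> carrier G" "v \<in> carrier G"
  shows "q \<otimes> commutator G u v \<otimes> inv q = commutator G (q \<otimes> u \<otimes> inv q) (q \<otimes> v \<otimes> inv q)"
  using assms by (simp add: commutator_def group_word_simps)

text \<open>With \<open>q\<close> a power of \<open>p\<close>, this peels one conjugate of [p,b] off
  the commutator of the next power with \<open>b\<close>.\<close>

lemma commutator_mult_left:
  assumes "q \<in> carrier G" "p \<in> carrier G" "b \<in> carrier G"
  shows "commutator G (q \<otimes> p) b = q \<otimes> commutator G p b \<otimes> inv q \<otimes> commutator G q b"
  using assms by (simp add: commutator_def group_word_simps)

text \<open>An identity in the free group on \<open>p\<close> and \<open>b\<close>. The two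
  arguments on the right are the conjugates by pb of p^-1 b^-1 and p b^-1, whose commutator is p^-1
  b^-1 p p b p^-1.\<close>

lemma commutator_mult_conj:
  assumes "p \<in> carrier G" "b \<in> carrier G"
  defines "c \<equiv> commutator G p b"
  shows "c \<otimes> p \<otimes> c \<otimes> inv p =
    commutator G (p \<otimes> b \<otimes> inv p \<otimes> inv b \<otimes> inv b \<otimes> inv p) (p \<otimes> b \<otimes> p \<otimes> inv b \<otimes> inv b \<otimes> inv p)"
  using assms by (simp add: commutator_def group_word_simps)

lemma central_pow_commutator_products:
  assumes H: "subgroup H G" and pb: "p \<in> H" "b \<in> H"
    and z: "commutator G p b \<otimes> commutator G p b = z"
    and central: "\<And>x. x \<in> carrier G \<Longrightarrow> z \<otimes> x = x \<otimes> z"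
  shows "z [^] (2 * n) \<in> commutator_products G H (n + 1)"
    and "z [^] (2 * n + 1) \<in> commutator_products G H (n + 2)"
proof -
  define c where "c = commutator G p b"
  \<comment> \<open>\<open>d m\<close> is the conjugate written \<open>c\<^sub>m\<close> in the
    introduction; the letter \<open>c\<close> is its case m = 0.\<close>
  define d where "d m = p [^] m \<otimes> c \<otimes> inv (p [^] m)" for m :: nat
  have HC [simp]: "x \<in> carrier G" if "x \<in> H" for x
    using that by (rule subgroup.mem_carrier[OF H])
  have closed [simp]: "p \<in> carrier G" "b \<in> carrier G" "c \<in> carrier G" "z \<in> carrier G" "d m \<in> carrier G" for m
    using pb z by (auto simp: c_def d_def)
  have powH: "p [^] m \<in> H" for m :: nat
    using pb by (induction m) (auto intro!: subgroup.one_closed[OF H] subgroup.m_closed[OF H])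
  have cc: "c \<otimes> (c \<otimes> x) = z \<otimes> x" if "x \<in> carrier G" for x
    using that z by (simp add: c_def flip: m_assoc)
  have dd: "d m \<otimes> d m = z" for m
  proof -
    have "d m \<otimes> d m = p [^] m \<otimes> (z \<otimes> inv (p [^] m))"
      by (simp add: d_def group_word_simps cc)
    also have "\<dots> = z" by (simp add: central[of "inv (p [^] m)"] inv_mult_cancel_left)
    finally show ?thesis .
  qed
  have step: "commutator G (p [^] Suc m) b = d m \<otimes> commutator G (p [^] m) b" for m
    using commutator_mult_left[of "p [^] m" p b] by (simp add: d_def c_def)
  have d_comm: "d m \<in> commutator_products G H 1" for m
    unfolding d_def c_def conj_commutator[OF nat_pow_closed[OF closed(1)] closed(1,2)]
    using H powH pb by (intro commutator_in_commutator_products) (auto intro!: subgroup.m_closed[OF H] subgroup.m_inv_closed[OF H])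
  have "d m \<otimes> d (Suc m) \<in> commutator_products G H 1" for m
  proof -
    let ?u = "p \<otimes> b \<otimes> inv p \<otimes> inv b \<otimes> inv b \<otimes> inv p" and ?v = "p \<otimes> b \<otimes> p \<otimes> inv b \<otimes> inv b \<otimes> inv p"
    have uv: "?u \<in> H" "?v \<in> H" using pb by (auto intro!: subgroup.m_closed[OF H] subgroup.m_inv_closed[OF H])
    have "d m \<otimes> d (Suc m) = p [^] m \<otimes> (c \<otimes> p \<otimes> c \<otimes> inv p) \<otimes> inv (p [^] m)"
      by (simp add: d_def group_word_simps)
    also have "c \<otimes> p \<otimes> c \<otimes> inv p = commutator G ?u ?v"
      unfolding c_def by (rule commutator_mult_conj) simp_all
    also have "p [^] m \<otimes> \<dots> \<otimes> inv (p [^] m) =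
        commutator G (p [^] m \<otimes> ?u \<otimes> inv (p [^] m)) (p [^] m \<otimes> ?v \<otimes> inv (p [^] m))"
      by (rule conj_commutator) simp_all
    also have "\<dots> \<in> commutator_products G H 1"
      using H powH uv by (intro commutator_in_commutator_products) (auto intro!: subgroup.m_closed[OF H] subgroup.m_inv_closed[OF H])
    finally show ?thesis .
  qed
  note dd_comm = this
  \<comment> \<open>The witness is the increasing product (d_0 d_1)(d_2 d_3)... of pairs,
    \<open>n\<close> commutators in all. The commutator of p^(2n) with \<open>b\<close> is the same
    product in decreasing order, so equal factors meet in the middle and collapse outwards to powers
    of \<open>z\<close>.\<close>
  have even: "\<exists>h \<in> commutator_products G H n. z [^] (2 * n) = h \<otimes> commutator G (p [^] (2 * n)) b" for n
  proof (induction n)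
    case 0
    show ?case
      using one_commutator_products[OF H, of 0] by (intro bexI[of _ \<one>]) (simp_all add: commutator_def)
  next
    case (Suc n)
    then obtain h where h: "h \<in> commutator_products G H n"
        "z [^] (2 * n) = h \<otimes> commutator G (p [^] (2 * n)) b" by blast
    have hC [simp]: "h \<in> carrier G" using commutator_products_closed[OF H, of n] h by auto
    let ?e = "commutator G (p [^] (2 * n)) b" and ?d0 = "d (2 * n)" and ?d1 = "d (Suc (2 * n))"
    have d_d: "d m \<otimes> (d m \<otimes> x) = z \<otimes> x" if "x \<in> carrier G" for x m
      using that dd[of m] by (simp flip: m_assoc)
    have "h \<otimes> (?d0 \<otimes> ?d1) \<otimes> commutator G (p [^] (2 * Suc n)) b =
        h \<otimes> (?d0 \<otimes> (?d1 \<otimes> (?d1 \<otimes> (?d0 \<otimes> ?e))))"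
      using step[of "2 * n"] step[of "Suc (2 * n)"] by (simp add: m_assoc)
    also have "?d1 \<otimes> (?d1 \<otimes> (?d0 \<otimes> ?e)) = ?d0 \<otimes> ?e \<otimes> z"
      using d_d central[of "?d0 \<otimes> ?e"] by simp
    also have "?d0 \<otimes> (?d0 \<otimes> ?e \<otimes> z) = ?e \<otimes> z \<otimes> z"
      using d_d[of "?e \<otimes> z" "2 * n"] central[of "?e \<otimes> z"] by (simp add: m_assoc)
    also have "h \<otimes> (?e \<otimes> z \<otimes> z) = z [^] (2 * Suc n)"
      using h by (simp flip: m_assoc)
    finally show ?case
      using mult_commutator_products[OF H h(1) dd_comm[of "2 * n"]]
      by (intro bexI[of _ "h \<otimes> (?d0 \<otimes> ?d1)"]) simp_all
  qed
  then obtain h where h: "h \<in> commutator_products G H n"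
      "z [^] (2 * n) = h \<otimes> commutator G (p [^] (2 * n)) b" by blast
  have hC [simp]: "h \<in> carrier G" using commutator_products_closed[OF H, of n] h by auto
  show "z [^] (2 * n) \<in> commutator_products G H (n + 1)"
    unfolding h(2)
    using powH pb by (intro mult_commutator_products[OF H h(1)] commutator_in_commutator_products[OF H])
  \<comment> \<open>For an odd exponent the factor \<open>d (2 * n)\<close> stays without a partner.
    It costs a commutator of its own, hence the count \<open>n + 2\<close>.\<close>
  have "z [^] (2 * n + 1) = h \<otimes> d (2 * n) \<otimes> commutator G (p [^] Suc (2 * n)) b"
  proof -
    have "h \<otimes> d (2 * n) \<otimes> commutator G (p [^] Suc (2 * n)) b =
        h \<otimes> (d (2 * n) \<otimes> d (2 * n) \<otimes> commutator G (p [^] (2 * n)) b)"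
      unfolding step by (simp add: m_assoc)
    also have "\<dots> = h \<otimes> commutator G (p [^] (2 * n)) b \<otimes> z"
      unfolding dd by (simp add: m_assoc central[of "commutator G (p [^] (2 * n)) b"])
    also have "\<dots> = z [^] (2 * n + 1)" using h by simp
    finally show ?thesis ..
  qed
  moreover have "h \<otimes> d (2 * n) \<otimes> commutator G (p [^] Suc (2 * n)) b \<in> commutator_products G H (n + 2)"
    using mult_commutator_products[OF H mult_commutator_products[OF H h(1) d_comm[of "2 * n"]]
        commutator_in_commutator_products[OF H powH[of "Suc (2 * n)"] pb(2)]]
    by (simp only: add.assoc one_add_one)
  ultimately show "z [^] (2 * n + 1) \<in> commutator_products G H (n + 2)" by (simp only:)
qed

lemma central_pow_in_commutator_products:
  assumes H: "subgroup H G" and pb: "p \<in> H" "b \<in> H"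
    and z: "commutator G p b \<otimes> commutator G p b = z"
    and central: "\<And>x. x \<in> carrier G \<Longrightarrow> z \<otimes> x = x \<otimes> z"
    and g: "g \<ge> 2" "\<bar>k\<bar> \<le> 2 * int g - 2"
  shows "z [^] (k :: int) \<in> commutator_products G H g"
proof -
  have "p \<in> carrier G" "b \<in> carrier G"
    using pb subgroup.mem_carrier[OF H] by blast+
  then have zC: "z \<in> carrier G"
    unfolding z[symmetric] by (intro m_closed commutator_closed)
  have nat: "z [^] m \<in> commutator_products G H g" if "m \<le> 2 * g - 2" for m :: nat
  proof (cases "even m")
    case True
    then obtain n where m: "m = 2 * n" by blast
    have "z [^] m \<in> commutator_products G H (n + 1)"
      unfolding m by (rule central_pow_commutator_products(1)[OF H pb z central])
    then show ?thesis
      using that m g by (elim commutator_products_mono[OF H]) linarith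
  next
    case False
    \<comment> \<open>As 2g - 2 is even, an odd \<open>m\<close> is at most 2g - 3, which leaves
      room for the extra commutator: n + 2 \<le> g.\<close>
    then obtain n where m: "m = 2 * n + 1" by (auto elim: oddE)
    have "z [^] m \<in> commutator_products G H (n + 2)"
      unfolding m by (rule central_pow_commutator_products(2)[OF H pb z central])
    then show ?thesis
      using that m g by (elim commutator_products_mono[OF H]) linarith
  qed
  show ?thesis
  proof (cases k)
    case (nonneg m)
    then have "m \<le> 2 * g - 2" using g by linarith
    then show ?thesis unfolding nonneg int_pow_int by (rule nat)
  next
    case (neg m)
    have "z [^] k = inv (z [^] Suc m)"
      unfolding neg int_pow_neg[OF zC] int_pow_int ..
    also have "\<dots> \<in> commutator_products G H g"
      using neg g by (intro inv_commutator_products[OF H] nat) linarith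
    finally show ?thesis .
  qed
qed

end

section \<open>Commutators in the universal cover\<close>

context topological_group
begin

lemma continuous_map_inv:
  "continuous_map X T f \<Longrightarrow> continuous_map X T (\<lambda>x. inv (f x))"
  using continuous_map_compose[OF _ continuous_inv] by (simp add: o_def)

lemma continuous_map_commutator:
  "continuous_map X T f \<Longrightarrow> continuous_map X T h \<Longrightarrow>
    continuous_map X T (\<lambda>x. commutator G (f x) (h x))"
  unfolding commutator_def by (intro continuous_map_mult continuous_map_inv)

lemma carrier_universal_cover: "carrier (universal_cover G T) = based_paths G T // path_homotopy G T"
  by (simp add: universal_cover_def)

text \<open>\<open>homotopic_with\<close> prescribes the two ends of the homotopy on the whole real
  line. The characterization used here relaxes this to the unit interval, so that explicit formulas
  can serve as homotopies. The first coordinate is the homotopy parameter.\<close>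

lemma path_homotopyI:
  fixes h :: "real \<times> real \<Rightarrow> 'a"
  assumes "p \<in> based_paths G T" "q \<in> based_paths G T"
    and "continuous_map (prod_topology (top_of_set {0..1}) (top_of_set {0..1})) T h"
    and "\<And>t. t \<in> {0..1} \<Longrightarrow> h (0, t) = p t" "\<And>t. t \<in> {0..1} \<Longrightarrow> h (1, t) = q t"
    and "\<And>s. s \<in> {0..1} \<Longrightarrow> h (s, 0) = \<one> \<and> h (s, 1) = p 1"
  shows "(p, q) \<in> path_homotopy G T"
proof -
  have "homotopic_with (\<lambda>h. h 0 = \<one> \<and> h 1 = p 1) (top_of_set {0..1}) T p q"
  proof (subst homotopic_with)
    show "\<exists>h :: real \<times> real \<Rightarrow> 'a. continuous_map (prod_topology (top_of_set {0..1}) (top_of_set {0..1})) T h \<and>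
        (\<forall>x\<in>topspace (top_of_set {0..1}). h (0, x) = p x) \<and>
        (\<forall>x\<in>topspace (top_of_set {0..1}). h (1, x) = q x) \<and>
        (\<forall>s\<in>{0..1}. h (s, 0) = \<one> \<and> h (s, 1) = p 1)"
      using assms(3-6) by (intro exI[of _ h]) simp
  qed simp
  with assms show ?thesis by (simp add: path_homotopy_def)
qed

lemma continuous_map_based_path:
  assumes "p \<in> based_paths G T" "continuous_on ({0..1} \<times> {0..1}) f"
    and "\<And>s t. s \<in> {0..1} \<Longrightarrow> t \<in> {0..1} \<Longrightarrow> f (s, t) \<in> {0..1}"
  shows "continuous_map (prod_topology (top_of_set {0..1}) (top_of_set {0..1})) T (\<lambda>x. p (f x))"
proof -
  have "continuous_map (prod_topology (top_of_set {0..1}) (top_of_set {0..1})) (top_of_set {0..1}) f"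
    using assms(2,3) by (auto simp flip: subtopology_Times)
  from continuous_map_compose[OF this, of T p] show ?thesis
    using assms(1) by (simp add: based_paths_def pathin_def o_def)
qed

lemma based_paths_0: "p \<in> based_paths G T \<Longrightarrow> p 0 = \<one>"
  by (simp add: based_paths_def)

lemma based_paths_commutator:
  assumes "p \<in> based_paths G T" "q \<in> based_paths G T"
  shows "(\<lambda>t. commutator G (p t) (q t)) \<in> based_paths G T"
  unfolding commutator_def using assms by (intro based_paths_mult based_paths_inv)

text \<open>The homotopy conjugates p(t) by q(st), so the conjugator grows with \<open>s\<close>
  from the identity to q(t). At t = 1 the conjugation has no effect because p(1) is trivial, and the
  endpoint stays fixed.\<close>

lemma cover_kernel_central:
  assumes X: "X \<in> carrier (universal_cover G T)" "cover_map X = \<one>"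
    and Y: "Y \<in> carrier (universal_cover G T)"
  shows "X \<otimes>\<^bsub>universal_cover G T\<^esub> Y = Y \<otimes>\<^bsub>universal_cover G T\<^esub> X"
proof -
  obtain p q where p: "p \<in> based_paths G T" "X = path_homotopy G T `` {p}"
    and q: "q \<in> based_paths G T" "Y = path_homotopy G T `` {q}"
    using X(1) Y unfolding carrier_universal_cover by (metis quotientE)
  have p1: "p 1 = \<one>" using X(2) p by (simp add: cover_map_class)
  let ?h = "\<lambda>(s, t). q (s * t) \<otimes> p t \<otimes> inv (q (s * t)) \<otimes> q t"
  have mem: "s * t \<in> {0..1}" if "s \<in> {0..1}" "t \<in> {0..1}" for s t :: real
    using that by (auto intro: mult_le_one)
  have "continuous_map (prod_topology (top_of_set {0..1}) (top_of_set {0..1})) T ?h"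
    unfolding case_prod_beta using mem
    by (intro continuous_map_mult continuous_map_inv continuous_map_based_path p q continuous_intros) auto
  then have "(\<lambda>t. p t \<otimes> q t, \<lambda>t. q t \<otimes> p t) \<in> path_homotopy G T"
    using p q p1 by (elim path_homotopyI[rotated 2])
      (auto intro!: based_paths_mult simp: based_paths_carrier based_paths_0 m_assoc)
  then show ?thesis
    using p q by (simp add: universal_cover_mult equiv_class_eq[OF equiv_path_homotopy])
qed

lemma universal_cover_inv:
  assumes "p \<in> based_paths G T"
  shows "inv\<^bsub>universal_cover G T\<^esub> (path_homotopy G T `` {p}) = path_homotopy G T `` {\<lambda>t. inv p t}"
proof -
  interpret U: group "universal_cover G T" by (rule group_universal_cover)
  have "(\<lambda>t. inv p t \<otimes> p t, \<lambda>_. \<one>) \<in> path_homotopy G T"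
    using assms by (intro path_homotopy_cong) (auto simp: based_paths_mult based_paths_inv based_paths_carrier)
  from equiv_class_eq[OF equiv_path_homotopy this]
  have "path_homotopy G T `` {\<lambda>t. inv p t} \<otimes>\<^bsub>universal_cover G T\<^esub> path_homotopy G T `` {p} =
      \<one>\<^bsub>universal_cover G T\<^esub>"
    using assms by (simp add: universal_cover_mult based_paths_inv) (simp add: universal_cover_def)
  then show ?thesis
    using assms by (intro U.inv_equality) (auto simp: carrier_universal_cover based_paths_inv intro: quotientI)
qed

lemma universal_cover_commutator:
  assumes "p \<in> based_paths G T" "q \<in> based_paths G T"
  shows "commutator (universal_cover G T) (path_homotopy G T `` {p}) (path_homotopy G T `` {q}) =
    path_homotopy G T `` {\<lambda>t. commutator G (p t) (q t)}"
  using assms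
  by (simp add: commutator_def universal_cover_mult universal_cover_inv based_paths_mult based_paths_inv)

text \<open>Only one of the two paths has to move: the homotopy pushes the argument of
  \<open>q\<close> towards 1. The start stays trivial because p(0) is, whatever the value of
  \<open>q\<close>. The explicit matrix computation thus has a single varying matrix.\<close>

lemma universal_cover_commutator_const:
  assumes p: "p \<in> based_paths G T" and q: "q \<in> based_paths G T"
  shows "commutator (universal_cover G T) (path_homotopy G T `` {p}) (path_homotopy G T `` {q}) =
    path_homotopy G T `` {\<lambda>t. commutator G (p t) (q 1)}"
proof -
  let ?h = "\<lambda>(s, t). commutator G (p t) (q (s + (1 - s) * t))"
  have mem: "s + (1 - s) * t \<in> {0..1}" if "s \<in> {0..1}" "t \<in> {0..1}" for s t :: real
    using that convex_bound_le[of 1 1 t s "1 - s"] by auto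
  have q1: "q 1 \<in> carrier G" using q by (simp add: based_paths_carrier)
  have "continuous_map (top_of_set {0..1::real}) T (\<lambda>t. commutator G (p t) (q 1))"
    using p q1 by (intro continuous_map_commutator) (auto simp: based_paths_def pathin_def topspace_eq)
  then have q': "(\<lambda>t. commutator G (p t) (q 1)) \<in> based_paths G T"
    using p q1 commutator_one_left by (simp add: based_paths_def pathin_def)
  have "continuous_map (prod_topology (top_of_set {0..1}) (top_of_set {0..1})) T ?h"
    unfolding case_prod_beta using mem
    by (intro continuous_map_commutator continuous_map_based_path p q continuous_intros) auto
  then have "(\<lambda>t. commutator G (p t) (q t), \<lambda>t. commutator G (p t) (q 1)) \<in> path_homotopy G T"
    using p q mem q' commutator_one_left based_paths_carrier[OF q]
    by (elim path_homotopyI[rotated 2]) (auto simp: based_paths_0 based_paths_commutator)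
  then show ?thesis
    using universal_cover_commutator[OF p q] equiv_class_eq[OF equiv_path_homotopy] by metis
qed

text \<open>Two lifts of one element differ by an element of the kernel, which is central and
  cancels in a commutator. This is why the Euler class does not depend on the lifts.\<close>

lemma commutator_cong_cover_map:
  assumes "X \<in> carrier (universal_cover G T)" "X' \<in> carrier (universal_cover G T)"
    and "Y \<in> carrier (universal_cover G T)" "Y' \<in> carrier (universal_cover G T)"
    and "cover_map X = cover_map X'" "cover_map Y = cover_map Y'"
  shows "commutator (universal_cover G T) X Y = commutator (universal_cover G T) X' Y'"
proof -
  interpret U: group "universal_cover G T" by (rule group_universal_cover)
  interpret cover: group_hom "universal_cover G T" G cover_map
    by unfold_locales (rule cover_map_hom)
  let ?U = "universal_cover G T"
  have ex: "\<exists>K\<in>carrier ?U. cover_map K = \<one> \<and> A = K \<otimes>\<^bsub>?U\<^esub> A'"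
    if "A \<in> carrier ?U" "A' \<in> carrier ?U" "cover_map A = cover_map A'" for A A'
    using that by (intro bexI[of _ "A \<otimes>\<^bsub>?U\<^esub> inv\<^bsub>?U\<^esub> A'"]) (simp_all add: U.m_assoc)
  obtain K L where K: "K \<in> carrier ?U" "cover_map K = \<one>" "X = K \<otimes>\<^bsub>?U\<^esub> X'"
    and L: "L \<in> carrier ?U" "cover_map L = \<one>" "Y = L \<otimes>\<^bsub>?U\<^esub> Y'"
    using ex assms by meson
  have left: "commutator ?U (K \<otimes>\<^bsub>?U\<^esub> A) B = commutator ?U A B"
    if "K \<in> carrier ?U" "cover_map K = \<one>" "A \<in> carrier ?U" "B \<in> carrier ?U" for K A B
  proof -
    let ?D = "A \<otimes>\<^bsub>?U\<^esub> B \<otimes>\<^bsub>?U\<^esub> inv\<^bsub>?U\<^esub> A"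
    have "commutator ?U (K \<otimes>\<^bsub>?U\<^esub> A) B = K \<otimes>\<^bsub>?U\<^esub> (?D \<otimes>\<^bsub>?U\<^esub> (inv\<^bsub>?U\<^esub> K \<otimes>\<^bsub>?U\<^esub> inv\<^bsub>?U\<^esub> B))"
      using that by (simp add: commutator_def U.group_word_simps)
    also have "inv\<^bsub>?U\<^esub> K \<otimes>\<^bsub>?U\<^esub> inv\<^bsub>?U\<^esub> B = inv\<^bsub>?U\<^esub> B \<otimes>\<^bsub>?U\<^esub> inv\<^bsub>?U\<^esub> K"
      using that by (intro cover_kernel_central) auto
    also have "K \<otimes>\<^bsub>?U\<^esub> (?D \<otimes>\<^bsub>?U\<^esub> (inv\<^bsub>?U\<^esub> B \<otimes>\<^bsub>?U\<^esub> inv\<^bsub>?U\<^esub> K)) =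
        ?D \<otimes>\<^bsub>?U\<^esub> (inv\<^bsub>?U\<^esub> B \<otimes>\<^bsub>?U\<^esub> inv\<^bsub>?U\<^esub> K) \<otimes>\<^bsub>?U\<^esub> K"
      using that by (intro cover_kernel_central) auto
    also have "\<dots> = commutator ?U A B"
      using that by (simp add: commutator_def U.group_word_simps)
    finally show ?thesis .
  qed
  have "commutator ?U X Y = commutator ?U X' Y"
    unfolding K(3) using K assms by (intro left) auto
  \<comment> \<open>Inversion swaps the arguments, so the fact for the first argument also serves
    the second.\<close>
  also have "\<dots> = inv\<^bsub>?U\<^esub> (commutator ?U (L \<otimes>\<^bsub>?U\<^esub> Y') X')"
    using assms by (simp add: U.inv_commutator flip: L(3))
  also have "\<dots> = commutator ?U X' Y'"
    using L assms by (simp add: left U.inv_commutator)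
  finally show ?thesis .
qed

end

section \<open>Paths in \<open>PSL(2,\<real>)\<close>\<close>

definition mat2 :: "real \<Rightarrow> real \<Rightarrow> real \<Rightarrow> real \<Rightarrow> real^2^2" where
  "mat2 a b c d = vector [vector [a, b], vector [c, d]]"

lemma mat2_nth [simp]:
  "mat2 a b c d $ 1 $ 1 = a" "mat2 a b c d $ 1 $ 2 = b"
  "mat2 a b c d $ 2 $ 1 = c" "mat2 a b c d $ 2 $ 2 = d"
  by (simp_all add: mat2_def)

lemma mat2_eq_iff: "mat2 a b c d = mat2 a' b' c' d' \<longleftrightarrow> a = a' \<and> b = b' \<and> c = c' \<and> d = d'"
  by (auto simp: vec_eq_iff forall_2)

lemma mat2_nth_self: "mat2 (A $ 1 $ 1) (A $ 1 $ 2) (A $ 2 $ 1) (A $ 2 $ 2) = A"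
  by (simp add: vec_eq_iff forall_2)

lemma mat2_mult: "mat2 a b c d ** mat2 a' b' c' d' =
    mat2 (a * a' + b * c') (a * b' + b * d') (c * a' + d * c') (c * b' + d * d')"
  by (simp add: vec_eq_iff forall_2 matrix_matrix_mult_def sum_2)

lemma mat2_one: "mat 1 = mat2 1 0 0 1"
  by (simp add: vec_eq_iff forall_2 mat_def)

lemma mat2_uminus: "- mat2 a b c d = mat2 (- a) (- b) (- c) (- d)"
  by (simp add: vec_eq_iff forall_2)

lemma mat2_SL2R [simp]: "mat2 a b c d \<in> carrier SL2R \<longleftrightarrow> a * d - b * c = 1"
  by (simp add: SL2R_def det_2)

lemma mat2_SL2R_inv: "a * d - b * c = 1 \<Longrightarrow> inv\<^bsub>SL2R\<^esub> (mat2 a b c d) = mat2 d (- b) (- c) a"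
  by (simp add: SL2R_inv) (simp add: mat2_def)

lemma SL2R_mult: "A \<otimes>\<^bsub>SL2R\<^esub> B = A ** B"
  by (simp add: SL2R_def)

lemma rotation_eq_mat2: "rotation t = mat2 (cos t) (sin t) (- sin t) (cos t)"
  by (simp add: rotation_def mat2_def)

lemma rotation_mult: "rotation s ** rotation t = rotation (s + t)"
  by (simp add: rotation_eq_mat2 mat2_mult mat2_eq_iff cos_add sin_add)

lemma continuous_on_mat2 [continuous_intros]:
  assumes "continuous_on S a" "continuous_on S b" "continuous_on S c" "continuous_on S d"
  shows "continuous_on S (\<lambda>x. mat2 (a x) (b x) (c x) (d x))"
proof -
  have "continuous_on S (\<lambda>x. mat2 (a x) (b x) (c x) (d x) $ i $ j)" for i j
    using exhaust_2[of i] exhaust_2[of j] assms by (elim disjE) simp_all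
  then have "continuous_on S (\<lambda>x. \<chi> i j. mat2 (a x) (b x) (c x) (d x) $ i $ j)"
    by (intro continuous_on_vec_lambda)
  then show ?thesis by (simp only: vec_lambda_eta)
qed

interpretation SL: group SL2R by (rule group_SL2R)
interpretation PSL: topological_group PSL2R PSL_topology by (rule topological_group_PSL2R)
interpretation cover: group PSL_cover by (rule group_PSL_cover)

abbreviation PSL_class :: "(real \<Rightarrow> real^2^2) \<Rightarrow> (real \<Rightarrow> (real^2^2) set) set" where
  "PSL_class M \<equiv> path_homotopy PSL2R PSL_topology `` {\<lambda>t. PSL_proj (M t)}"

text \<open>Lifts to SL(2,\<real>) of based paths in PSL(2,\<real>), so that classes can be computed
  with matrices in place of cosets.\<close>

definition SL_paths :: "(real \<Rightarrow> real^2^2) set" where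
  "SL_paths = {M. continuous_on {0..1} M \<and> M ` {0..1} \<subseteq> carrier SL2R \<and> M 0 = mat 1}"

lemma SL_path_in_based_paths:
  assumes "M \<in> SL_paths" shows "(\<lambda>t. PSL_proj (M t)) \<in> based_paths PSL2R PSL_topology"
proof -
  have "continuous_map (top_of_set {0..1}) (top_of_set (carrier SL2R)) M"
    using assms by (auto simp: SL_paths_def)
  from continuous_map_compose[OF this quotient_imp_continuous_map[OF quotient_map_PSL_proj]]
  show ?thesis using assms
    by (simp add: based_paths_def pathin_def o_def PSL_proj_one SL_paths_def)
qed

lemma PSL_class_closed: "M \<in> SL_paths \<Longrightarrow> PSL_class M \<in> carrier PSL_cover"
  by (simp add: PSL_cover_def PSL.carrier_universal_cover SL_path_in_based_paths quotientI)

lemma cover_map_PSL_class: "M \<in> SL_paths \<Longrightarrow> cover_map (PSL_class M) = PSL_proj (M 1)"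
  by (simp add: cover_map_class SL_path_in_based_paths)

lemma PSL_class_mult:
  assumes "M \<in> SL_paths" "N \<in> SL_paths"
  shows "PSL_class M \<otimes>\<^bsub>PSL_cover\<^esub> PSL_class N = PSL_class (\<lambda>t. M t ** N t)"
proof -
  have "(\<lambda>t. PSL_proj (M t) \<otimes>\<^bsub>PSL2R\<^esub> PSL_proj (N t), \<lambda>t. PSL_proj (M t ** N t)) \<in>
      path_homotopy PSL2R PSL_topology"
    using assms by (intro PSL.path_homotopy_cong PSL.based_paths_mult SL_path_in_based_paths PSL_proj_mult)
      (auto simp: SL_paths_def)
  from equiv_class_eq[OF equiv_path_homotopy this] show ?thesis
    using assms by (simp add: PSL_cover_def PSL.universal_cover_mult SL_path_in_based_paths)
qed

lemma PSL_commutator: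
  assumes "A \<in> carrier SL2R" "B \<in> carrier SL2R"
  shows "commutator PSL2R (PSL_proj A) (PSL_proj B) = PSL_proj (commutator SL2R A B)"
  using assms SL.m_closed SL.inv_closed
  by (simp add: commutator_def PSL_proj_inv PSL_proj_mult SL2R_mult)

text \<open>A matrix of determinant 1 is determined by its first row \<open>(x, y)\<close> and by the inner product
  \<open>\<tau>\<close> of its rows. In these coordinates \<open>positive_row\<close> describes a
  convex set, so paths in it are homotopic along straight lines.\<close>

definition row_coords :: "real \<Rightarrow> real \<Rightarrow> real \<Rightarrow> real^2^2" where
  "row_coords x y \<tau> = mat2 x y ((\<tau> * x - y) / (x\<^sup>2 + y\<^sup>2)) ((\<tau> * y + x) / (x\<^sup>2 + y\<^sup>2))"

lemma row_coords_SL2R: "x \<noteq> 0 \<or> y \<noteq> 0 \<Longrightarrow> row_coords x y \<tau> \<in> carrier SL2R"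
  unfolding row_coords_def mat2_SL2R
  by (subst times_divide_eq_right)+ (simp add: sum_power2_eq_zero_iff diff_divide_distrib[symmetric] algebra_simps power2_eq_square)

lemma row_coords_eq:
  assumes "A \<in> carrier SL2R"
  shows "row_coords (A $ 1 $ 1) (A $ 1 $ 2) (A $ 1 $ 1 * A $ 2 $ 1 + A $ 1 $ 2 * A $ 2 $ 2) = A"
proof -
  obtain a b c d where A: "A = mat2 a b c d" using mat2_nth_self by metis
  have det: "a * d - b * c = 1" using assms A by simp
  then have "a \<noteq> 0 \<or> b \<noteq> 0" by auto
  then have ab: "a\<^sup>2 + b\<^sup>2 \<noteq> 0" by (simp add: sum_power2_eq_zero_iff)
  \<comment> \<open>Inner product and determinant are two linear equations for the second row, and
    the determinant of that system is \<open>a\<^sup>2 + b\<^sup>2\<close>; this is Cramer's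
    rule.\<close>
  have "(a * c + b * d) * a - b * (a * d - b * c) = c * (a\<^sup>2 + b\<^sup>2)"
    "(a * c + b * d) * b + a * (a * d - b * c) = d * (a\<^sup>2 + b\<^sup>2)"
    by (simp_all add: algebra_simps power2_eq_square)
  then show ?thesis
    using ab by (simp add: A row_coords_def mat2_eq_iff det)
qed

text \<open>The first row, as a point of the plane, has argument in [0, pi). Including the ray of
  argument 0 admits the identity, where all paths start.\<close>

definition positive_row :: "real^2^2 \<Rightarrow> bool" where
  "positive_row A \<longleftrightarrow> A $ 1 $ 2 > 0 \<or> A $ 1 $ 2 = 0 \<and> A $ 1 $ 1 > 0"

text \<open>Joins \<open>M t\<close> to \<open>N t\<close> by a segment in row coordinates.
  Positivity keeps the mixed first row away from 0, and the common values at both ends are unchanged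
  by mixing. In general, paths with the same end may differ by a power of \<open>kernel_gen\<close>;
  here this is excluded.\<close>

lemma PSL_class_eqI:
  assumes M: "M \<in> SL_paths" "\<And>t. t \<in> {0..1} \<Longrightarrow> positive_row (M t)"
    and N: "N \<in> SL_paths" "\<And>t. t \<in> {0..1} \<Longrightarrow> positive_row (N t)"
    and eq: "M 1 = N 1"
  shows "PSL_class M = PSL_class N"
proof -
  define \<tau> where "\<tau> A = A $ 1 $ 1 * A $ 2 $ 1 + A $ 1 $ 2 * A $ 2 $ 2" for A :: "real^2^2"
  define mix where "mix s a b = (1 - s) * a + s * b" for s a b :: real
  define H where "H = (\<lambda>(s, t). row_coords (mix s (M t $ 1 $ 1) (N t $ 1 $ 1))
    (mix s (M t $ 1 $ 2) (N t $ 1 $ 2)) (mix s (\<tau> (M t)) (\<tau> (N t))))"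
  let ?I = "{0..1::real}"
  have nz: "mix s (M t $ 1 $ 1) (N t $ 1 $ 1) \<noteq> 0 \<or> mix s (M t $ 1 $ 2) (N t $ 1 $ 2) \<noteq> 0"
    if st: "s \<in> ?I" "t \<in> ?I" for s t
  proof -
    consider "s = 0" | "s = 1" | "0 < s" "s < 1" using st(1) by fastforce
    then show ?thesis
    proof cases
      case 3
      let ?x = "M t $ 1 $ 1" and ?y = "M t $ 1 $ 2" and ?x' = "N t $ 1 $ 1" and ?y' = "N t $ 1 $ 2"
      have pos: "?y > 0 \<or> ?y = 0 \<and> ?x > 0" "?y' > 0 \<or> ?y' = 0 \<and> ?x' > 0"
        using M(2) N(2) st(2) by (auto simp: positive_row_def)
      \<comment> \<open>Unless both second coordinates vanish, their mixture is positive; if both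
        vanish, both first coordinates are positive.\<close>
      then have "?y > 0 \<or> ?y' > 0 \<Longrightarrow> mix s ?y ?y' > 0"
        using 3 by (auto simp: mix_def intro: add_pos_nonneg add_nonneg_pos)
      moreover have "?x > 0 \<Longrightarrow> ?x' > 0 \<Longrightarrow> mix s ?x ?x' > 0"
        using 3 by (simp add: mix_def add_pos_pos)
      ultimately show ?thesis using pos by fastforce
    qed (use M(2)[OF st(2)] N(2)[OF st(2)] in \<open>auto simp: mix_def positive_row_def\<close>)
  qed
  have SL: "M t \<in> carrier SL2R" "N t \<in> carrier SL2R" if "t \<in> ?I" for t
    using that M(1) N(1) by (auto simp: SL_paths_def)
  have cM: "continuous_on (?I \<times> ?I) (\<lambda>x. M (snd x))" and cN: "continuous_on (?I \<times> ?I) (\<lambda>x. N (snd x))"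
    using M(1) N(1) by (auto simp: SL_paths_def intro!: continuous_on_compose2[of ?I] continuous_intros)
  have "continuous_on (?I \<times> ?I) H"
    unfolding H_def row_coords_def case_prod_beta mix_def \<tau>_def
    using nz[unfolded mix_def]
    by (intro continuous_intros cM cN) (auto simp: sum_power2_eq_zero_iff)
  moreover have "H ` (?I \<times> ?I) \<subseteq> carrier SL2R"
    using nz by (auto simp: H_def intro!: row_coords_SL2R)
  ultimately have "continuous_map (prod_topology (top_of_set ?I) (top_of_set ?I)) (top_of_set (carrier SL2R)) H"
    by (auto simp flip: subtopology_Times)
  from continuous_map_compose[OF this quotient_imp_continuous_map[OF quotient_map_PSL_proj]]
  have "continuous_map (prod_topology (top_of_set ?I) (top_of_set ?I)) PSL_topology (\<lambda>x. PSL_proj (H x))"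
    by (simp add: o_def)
  moreover have "H (0, t) = M t" "H (1, t) = N t" if "t \<in> ?I" for t
    using SL[OF that] by (simp_all add: H_def mix_def \<tau>_def row_coords_eq)
  moreover have "H (s, 0) = mat 1" "H (s, 1) = M 1" for s
  proof -
    have [simp]: "mix s a a = a" for a by (simp add: mix_def algebra_simps)
    show "H (s, 0) = mat 1" "H (s, 1) = M 1"
      using M(1) N(1) SL[of 0] SL[of 1] by (simp_all add: H_def row_coords_eq \<tau>_def SL_paths_def flip: eq)
  qed
  ultimately have "(\<lambda>t. PSL_proj (M t), \<lambda>t. PSL_proj (N t)) \<in> path_homotopy PSL2R PSL_topology"
    using M(1) N(1) by (intro PSL.path_homotopyI[where h = "\<lambda>x. PSL_proj (H x)"])
      (auto simp: SL_path_in_based_paths PSL_proj_one)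
  then show ?thesis by (rule equiv_class_eq[OF equiv_path_homotopy])
qed

lemma rotation_SL_path: "(\<lambda>t. rotation (c * t)) \<in> SL_paths"
proof -
  have "continuous_on {0..1} (\<lambda>t. rotation (c * t))"
    unfolding rotation_eq_mat2 by (intro continuous_intros)
  then show ?thesis by (auto simp: SL_paths_def rotation_SL2R rotation_0_pi)
qed

lemma kernel_gen_eq: "kernel_gen = PSL_class (\<lambda>t. rotation (pi * t))"
  by (simp add: kernel_gen_def)

text \<open>The segment from the identity to \<open>A\<close>, rescaled to determinant 1. For
  \<open>A\<close> of determinant 1 the radicand is the determinant of (1 - t) I + t A, positive on
  the unit interval when the trace is nonnegative.\<close>

definition SL_segment :: "real^2^2 \<Rightarrow> real \<Rightarrow> real^2^2" where
  "SL_segment A t = (let D = sqrt ((1 - t)\<^sup>2 + t * (1 - t) * (A $ 1 $ 1 + A $ 2 $ 2) + t\<^sup>2) in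
     mat2 ((1 - t + t * A $ 1 $ 1) / D) (t * A $ 1 $ 2 / D) (t * A $ 2 $ 1 / D) ((1 - t + t * A $ 2 $ 2) / D))"

lemma SL_segment_1: "SL_segment A 1 = A"
  by (simp add: SL_segment_def mat2_nth_self)

lemma SL_segment_det_pos:
  fixes A :: "real^2^2"
  assumes "A $ 1 $ 1 + A $ 2 $ 2 \<ge> 0" "t \<in> {0..1}"
  shows "(1 - t)\<^sup>2 + t * (1 - t) * (A $ 1 $ 1 + A $ 2 $ 2) + t\<^sup>2 > 0"
proof -
  have "(1 - t)\<^sup>2 + t\<^sup>2 > 0" by (cases "t = 0") (auto intro: add_nonneg_pos)
  moreover have "t * (1 - t) * (A $ 1 $ 1 + A $ 2 $ 2) \<ge> 0" using assms by simp
  ultimately show ?thesis by linarith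
qed

lemma SL_segment_SL_path:
  assumes A: "A \<in> carrier SL2R" "A $ 1 $ 1 + A $ 2 $ 2 \<ge> 0"
  shows "SL_segment A \<in> SL_paths"
proof -
  let ?D = "\<lambda>t. (1 - t)\<^sup>2 + t * (1 - t) * (A $ 1 $ 1 + A $ 2 $ 2) + t\<^sup>2"
  have pos: "?D t > 0" if "t \<in> {0..1}" for t using SL_segment_det_pos[OF A(2) that] .
  have "continuous_on {0..1} (SL_segment A)"
    unfolding SL_segment_def Let_def using pos
    by (intro continuous_intros) force+
  moreover have "SL_segment A t \<in> carrier SL2R" if "t \<in> {0..1}" for t
  proof -
    obtain a b c d where Aeq: "A = mat2 a b c d" using mat2_nth_self by metis
    have "(1 - t + t * a) * (1 - t + t * d) - t * b * (t * c) =
        (1 - t)\<^sup>2 + t * (1 - t) * (a + d) + t\<^sup>2 * (a * d - b * c)"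
      by (simp add: algebra_simps power2_eq_square)
    also have "\<dots> = ?D t" using A(1) by (simp add: Aeq)
    finally have "(1 - t + t * a) * (1 - t + t * d) - t * b * (t * c) = ?D t" .
    then show ?thesis
      using pos[OF that] by (simp add: SL_segment_def Let_def Aeq flip: diff_divide_distrib)
  qed
  moreover have "SL_segment A 0 = mat 1" by (simp add: SL_segment_def mat2_one)
  ultimately show ?thesis by (auto simp: SL_paths_def)
qed

section \<open>Commutator paths and the two generators\<close>

lemma PSL_cover_commutator_const:
  assumes P: "P \<in> SL_paths" and Q: "Q \<in> SL_paths"
  shows "(\<lambda>t. commutator SL2R (P t) (Q 1)) \<in> SL_paths"
    and "commutator PSL_cover (PSL_class P) (PSL_class Q) = PSL_class (\<lambda>t. commutator SL2R (P t) (Q 1))"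
proof -
  have mem: "P t \<in> carrier SL2R" "Q t \<in> carrier SL2R" if "t \<in> {0..1}" for t
    using P Q that by (auto simp: SL_paths_def)
  \<comment> \<open>\<open>?adj\<close> is inversion on matrices of determinant 1. Its entries are
    linear in those of the matrix, so continuity of the commutator can be read off
    entrywise.\<close>
  let ?adj = "\<lambda>A. mat2 (A $ 2 $ 2) (- A $ 1 $ 2) (- A $ 2 $ 1) (A $ 1 $ 1)"
  have mult: "A ** B = mat2 (A $ 1 $ 1 * B $ 1 $ 1 + A $ 1 $ 2 * B $ 2 $ 1) (A $ 1 $ 1 * B $ 1 $ 2 + A $ 1 $ 2 * B $ 2 $ 2)
      (A $ 2 $ 1 * B $ 1 $ 1 + A $ 2 $ 2 * B $ 2 $ 1) (A $ 2 $ 1 * B $ 1 $ 2 + A $ 2 $ 2 * B $ 2 $ 2)" for A B :: "real^2^2"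
    using mat2_mult[of "A $ 1 $ 1" "A $ 1 $ 2" "A $ 2 $ 1" "A $ 2 $ 2" "B $ 1 $ 1" "B $ 1 $ 2" "B $ 2 $ 1" "B $ 2 $ 2"]
    by (simp only: mat2_nth_self)
  have "continuous_on {0..1} P" using P by (simp add: SL_paths_def)
  then have "continuous_on {0..1} (\<lambda>t. P t ** Q 1 ** ?adj (P t) ** ?adj (Q 1))"
    unfolding mult mat2_nth by (intro continuous_intros)
  then have "continuous_on {0..1} (\<lambda>t. commutator SL2R (P t) (Q 1))"
    using mem by (elim continuous_on_eq) (simp add: commutator_def SL2R_mult SL2R_inv mat2_def)
  moreover have "commutator SL2R (P 0) (Q 1) = mat 1"
    using P mem(2)[of 1] SL.commutator_one_left[of "Q 1"] by (simp add: SL_paths_def SL2R_def)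
  ultimately show path: "(\<lambda>t. commutator SL2R (P t) (Q 1)) \<in> SL_paths"
    using mem by (auto simp: SL_paths_def)
  have "(\<lambda>t. PSL_proj (commutator SL2R (P t) (Q 1)),
      \<lambda>t. commutator PSL2R (PSL_proj (P t)) (PSL_proj (Q 1))) \<in> path_homotopy PSL2R PSL_topology"
    using path mem by (intro PSL.path_homotopy_cong SL_path_in_based_paths) (auto simp: PSL_commutator)
  from equiv_class_eq[OF equiv_path_homotopy this]
  show "commutator PSL_cover (PSL_class P) (PSL_class Q) = PSL_class (\<lambda>t. commutator SL2R (P t) (Q 1))"
    using P Q by (simp add: PSL_cover_def PSL.universal_cover_commutator_const SL_path_in_based_paths)
qed

text \<open>The commutator of these two matrices is \<open>rotation (pi / 2)\<close>, whose square is trivial in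
  \<open>PSL(2,\<real>)\<close>: they generate the fundamental group of a torus with one cone point of order 2.\<close>

definition gen_p :: "real^2^2" where
  "gen_p = mat2 ((sqrt 7 + 3) / 2) ((sqrt 7 + 1) / 2) ((1 - sqrt 7) / 2) ((sqrt 7 - 3) / 2)"

definition gen_b :: "real^2^2" where
  "gen_b = mat2 ((sqrt 7 - 3) / 2) ((1 - sqrt 7) / 2) ((sqrt 7 + 1) / 2) ((sqrt 7 + 3) / 2)"

lemma gen_SL2R: "gen_p \<in> carrier SL2R" "gen_b \<in> carrier SL2R"
  by (simp_all add: gen_p_def gen_b_def field_simps)

lemma gen_trace: "gen_p $ 1 $ 1 + gen_p $ 2 $ 2 = sqrt 7" "gen_b $ 1 $ 1 + gen_b $ 2 $ 2 = sqrt 7"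
  by (simp_all add: gen_p_def gen_b_def field_simps)

lemma sqrt7_mult_sqrt7: "sqrt 7 * (sqrt 7 * x) = 7 * x"
  by (simp flip: mult.assoc)

lemma gen_commutator: "commutator SL2R gen_p gen_b = rotation (pi / 2)"
proof -
  show ?thesis
    using gen_SL2R unfolding commutator_def gen_p_def gen_b_def SL2R_mult rotation_eq_mat2
    by (simp add: mat2_SL2R_inv mat2_mult mat2_eq_iff field_simps sqrt7_mult_sqrt7)
qed

text \<open>Positivity of a row is decided by this entry as soon as it is nonzero. With the scale
  \<open>s\<close> kept symbolic, the square root in \<open>SL_segment\<close> enters only through
  its square.\<close>

lemma commutator_scaled_12:
  fixes a b c d e f g h s :: real
  assumes "mat2 (a / s) (b / s) (c / s) (d / s) \<in> carrier SL2R" "mat2 e f g h \<in> carrier SL2R"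
  shows "commutator SL2R (mat2 (a / s) (b / s) (c / s) (d / s)) (mat2 e f g h) $ 1 $ 2 =
    (e * ((a * f + b * h) * a - (a * e + b * g) * b) - f * ((a * e + b * g) * d - (a * f + b * h) * c)) / (s * s)"
  using assms unfolding commutator_def SL2R_mult
  by (simp add: mat2_SL2R_inv mat2_mult)
    (simp add: diff_divide_distrib add_divide_distrib algebra_simps)

text \<open>The (1,2) entry is a positive multiple of t (1 - t) (sqrt 7 - 1) + t^2, which on the
  unit interval vanishes only at t = 0, where the commutator is the identity.\<close>

lemma gen_commutator_positive_row:
  assumes t: "t \<in> {0..1}"
  shows "positive_row (commutator SL2R (SL_segment gen_p t) gen_b)"
proof (cases "t = 0")
  case True
  have "SL_segment gen_p 0 = \<one>\<^bsub>SL2R\<^esub>"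
    by (simp add: SL_segment_def SL2R_def mat2_one)
  then have "commutator SL2R (SL_segment gen_p 0) gen_b = \<one>\<^bsub>SL2R\<^esub>"
    using gen_SL2R by (simp add: SL.commutator_one_left)
  then show ?thesis using True by (simp add: positive_row_def SL2R_def mat2_one)
next
  case False
  define D where "D = (1 - t)\<^sup>2 + t * (1 - t) * sqrt 7 + t\<^sup>2"
  have D: "D > 0" using SL_segment_det_pos[of gen_p t] t by (simp add: gen_trace D_def)
  have seg: "SL_segment gen_p t = mat2 ((1 - t + t * (sqrt 7 + 3) / 2) / sqrt D) (t * (sqrt 7 + 1) / 2 / sqrt D)
      (t * (1 - sqrt 7) / 2 / sqrt D) ((1 - t + t * (sqrt 7 - 3) / 2) / sqrt D)"
    unfolding SL_segment_def Let_def gen_trace D_def by (simp add: gen_p_def)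
  have P: "SL_segment gen_p t \<in> carrier SL2R"
    using SL_segment_SL_path[of gen_p] gen_SL2R gen_trace t by (auto simp: SL_paths_def)
  have "commutator SL2R (SL_segment gen_p t) gen_b $ 1 $ 2 = (t * (1 - t) * (sqrt 7 - 1) + t\<^sup>2) / (sqrt D * sqrt D)"
    unfolding seg gen_b_def commutator_scaled_12[OF P[unfolded seg] gen_SL2R(2)[unfolded gen_b_def]]
    by (rule arg_cong2[where f = "(/)"]) (simp_all add: field_simps power2_eq_square sqrt7_mult_sqrt7)
  then have "commutator SL2R (SL_segment gen_p t) gen_b $ 1 $ 2 = (t * (1 - t) * (sqrt 7 - 1) + t\<^sup>2) / D"
    using D by simp
  moreover have "t * (1 - t) * (sqrt 7 - 1) + t\<^sup>2 > 0"
    using t False by (intro add_nonneg_pos mult_nonneg_nonneg) auto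
  ultimately show ?thesis using D by (simp add: positive_row_def)
qed

text \<open>The endpoint alone fixes the lift only up to the kernel. Both paths have positive rows
  and the same end, so they are homotopic and the lift is known exactly; the value of the Euler
  class rests on this.\<close>

lemma gen_cover_commutator:
  "commutator PSL_cover (PSL_class (SL_segment gen_p)) (PSL_class (SL_segment gen_b)) =
     PSL_class (\<lambda>t. rotation (pi / 2 * t))"
proof -
  have seg: "SL_segment gen_p \<in> SL_paths" "SL_segment gen_b \<in> SL_paths"
    using gen_SL2R gen_trace by (auto intro!: SL_segment_SL_path)
  have "positive_row (rotation (pi / 2 * t))" if "t \<in> {0..1}" for t
  proof (cases "t = 0")
    case False
    then have "sin (pi / 2 * t) > 0" using that by (intro sin_gt_zero) (auto simp: field_simps)
    then show ?thesis by (simp add: positive_row_def rotation_eq_mat2)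
  qed (simp add: positive_row_def rotation_eq_mat2)
  then have "PSL_class (\<lambda>t. commutator SL2R (SL_segment gen_p t) (SL_segment gen_b 1)) =
      PSL_class (\<lambda>t. rotation (pi / 2 * t))"
    using PSL_cover_commutator_const(1)[OF seg] rotation_SL_path[of "pi / 2"] gen_commutator_positive_row
    by (intro PSL_class_eqI) (simp_all add: SL_segment_1 gen_commutator)
  then show ?thesis by (simp only: PSL_cover_commutator_const(2)[OF seg])
qed

lemma gen_cover_commutator_square:
  fixes p b
  defines "p \<equiv> PSL_class (SL_segment gen_p)" and "b \<equiv> PSL_class (SL_segment gen_b)"
  shows "commutator PSL_cover p b \<otimes>\<^bsub>PSL_cover\<^esub> commutator PSL_cover p b = kernel_gen"
  unfolding p_def b_def gen_cover_commutator PSL_class_mult[OF rotation_SL_path rotation_SL_path]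
    rotation_mult kernel_gen_eq by (simp add: mult.commute)

section \<open>The kernel of the universal cover\<close>

lemma kernel_gen_central:
  "X \<in> carrier PSL_cover \<Longrightarrow> kernel_gen \<otimes>\<^bsub>PSL_cover\<^esub> X = X \<otimes>\<^bsub>PSL_cover\<^esub> kernel_gen"
  using PSL.cover_kernel_central kernel_gen_kernel by (simp add: PSL_cover_def)

section \<open>Infinite order of the kernel generator\<close>

lemma PSL_cover_one: "\<one>\<^bsub>PSL_cover\<^esub> = PSL_class (\<lambda>t. rotation (0 * t))"
  by (simp add: PSL_cover_def universal_cover_def rotation_0_pi PSL_proj_one)

lemma kernel_gen_pow: "kernel_gen [^]\<^bsub>PSL_cover\<^esub> (n :: nat) = PSL_class (\<lambda>t. rotation (real n * pi * t))"
proof (induction n)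
  case 0
  show ?case using PSL_cover_one by simp
next
  case (Suc n)
  have "kernel_gen [^]\<^bsub>PSL_cover\<^esub> Suc n = PSL_class (\<lambda>t. rotation (real n * pi * t) ** rotation (pi * t))"
    by (simp only: cover.nat_pow_Suc Suc) (simp only: kernel_gen_eq PSL_class_mult rotation_SL_path)
  then show ?case by (simp add: rotation_mult algebra_simps)
qed

text \<open>Squaring removes the sign ambiguity of a coset, which gives a map from PSL(2,\<real>) to
  the nonzero complex numbers. It sends the rotation by \<theta> to exp(2 i \<theta>), hence the
  loop of \<open>kernel_gen\<close> to a loop going once around 0.\<close>

definition row_square :: "(real^2^2) set \<Rightarrow> complex" where
  "row_square X = the_elem ((\<lambda>A. (Complex (A $ 1 $ 1) (A $ 1 $ 2))\<^sup>2) ` X)"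

lemma row_square_proj: "row_square (PSL_proj A) = (Complex (A $ 1 $ 1) (A $ 1 $ 2))\<^sup>2"
proof -
  have "Complex (- A $ 1 $ 1) (- A $ 1 $ 2) = - Complex (A $ 1 $ 1) (A $ 1 $ 2)"
    by (simp add: complex_eq_iff)
  then show ?thesis by (simp add: row_square_def PSL_proj_eq)
qed

lemma continuous_map_row_square: "continuous_map PSL_topology (top_of_set (- {0})) row_square"
proof -
  have "Complex (A $ 1 $ 1) (A $ 1 $ 2) \<noteq> 0" if "A \<in> carrier SL2R" for A
    using that by (auto simp: SL2R_def det_2 complex_eq_iff)
  moreover have "continuous_on (carrier SL2R) (\<lambda>A. (Complex (A $ 1 $ 1) (A $ 1 $ 2))\<^sup>2)"
    unfolding Complex_eq by (intro continuous_intros)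
  ultimately have "continuous_map (top_of_set (carrier SL2R)) (top_of_set (- {0})) (row_square \<circ> PSL_proj)"
    by (auto simp: o_def row_square_proj)
  then show ?thesis
    using continuous_compose_quotient_map_eq[OF quotient_map_PSL_proj] by blast
qed

text \<open>Under \<open>row_square\<close>, a loop representing the n-th power winds
  \<open>n\<close> times around 0, whereas a null-homotopic loop has winding number 0.\<close>

lemma kernel_gen_pow_eq_one:
  assumes "kernel_gen [^]\<^bsub>PSL_cover\<^esub> (n :: nat) = \<one>\<^bsub>PSL_cover\<^esub>"
  shows "n = 0"
proof -
  let ?p = "\<lambda>t. PSL_proj (rotation (real n * pi * t))" and ?q = "\<lambda>t. PSL_proj (rotation (0 * t))"
  have "(?p, ?q) \<in> path_homotopy PSL2R PSL_topology"
    using assms unfolding kernel_gen_pow PSL_cover_one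
    by (rule eq_equiv_class[OF _ equiv_path_homotopy]) (intro SL_path_in_based_paths rotation_SL_path)
  then have "homotopic_with (\<lambda>h. h 0 = \<one>\<^bsub>PSL2R\<^esub> \<and> h 1 = ?p 1) (top_of_set {0..1}) PSL_topology ?p ?q"
    by (simp add: path_homotopy_def)
  from homotopic_with_compose_continuous_map_left[OF this continuous_map_row_square]
  have "homotopic_paths (- {0}) (row_square \<circ> ?p) (row_square \<circ> ?q)"
    unfolding homotopic_paths_def by (simp add: pathstart_def pathfinish_def rotation_0_pi PSL_proj_one o_def)
  then have "winding_number (row_square \<circ> ?p) 0 = winding_number (row_square \<circ> ?q) 0"
    by (rule winding_number_homotopic_paths)
  \<comment> \<open>The speed \<open>c\<close> is general because it is needed both for
    \<open>n * pi\<close> and for 0.\<close>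
  moreover have "winding_number (row_square \<circ> (\<lambda>t. PSL_proj (rotation (c * t)))) 0 = c / pi" for c
  proof -
    have "row_square \<circ> (\<lambda>t. PSL_proj (rotation (c * t))) = exp \<circ> (\<lambda>t. 2 * \<i> * of_real (c * t))"
    proof
      fix t
      have "(Complex (cos (c * t)) (sin (c * t)))\<^sup>2 = (exp (\<i> * of_real (c * t)))\<^sup>2"
        by (simp add: exp_Euler Complex_eq flip: cos_of_real sin_of_real)
      also have "\<dots> = exp (2 * \<i> * of_real (c * t))"
        by (simp add: power2_eq_square mult.assoc flip: exp_add)
      finally show "(row_square \<circ> (\<lambda>t. PSL_proj (rotation (c * t)))) t = (exp \<circ> (\<lambda>t. 2 * \<i> * of_real (c * t))) t"
        by (simp add: row_square_proj rotation_eq_mat2)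
    qed
    moreover have "path (\<lambda>t. 2 * \<i> * complex_of_real (c * t))"
      unfolding path_def by (intro continuous_intros)
    ultimately show ?thesis
      by (simp add: winding_number_compose_exp pathfinish_def pathstart_def)
  qed
  ultimately show ?thesis by (metis (no_types) div_0 divide_eq_0_iff mult_eq_0_iff of_nat_eq_0_iff of_real_eq_0_iff of_real_0 pi_neq_zero)
qed

lemma kernel_gen_int_pow_inj:
  assumes "kernel_gen [^]\<^bsub>PSL_cover\<^esub> (m :: int) = kernel_gen [^]\<^bsub>PSL_cover\<^esub> (n :: int)"
  shows "m = n"
proof -
  note z = kernel_gen_kernel(1)
  have "m = n" if "n \<le> m" "kernel_gen [^]\<^bsub>PSL_cover\<^esub> m = kernel_gen [^]\<^bsub>PSL_cover\<^esub> n" for m n :: int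
  proof -
    have "kernel_gen [^]\<^bsub>PSL_cover\<^esub> (m - n) = \<one>\<^bsub>PSL_cover\<^esub>"
      using that z by (simp add: cover.int_pow_diff)
    then have "kernel_gen [^]\<^bsub>PSL_cover\<^esub> nat (m - n) = \<one>\<^bsub>PSL_cover\<^esub>"
      using that int_pow_int[of PSL_cover kernel_gen "nat (m - n)"] by simp
    from kernel_gen_pow_eq_one[OF this] show ?thesis using that by simp
  qed
  then show ?thesis using assms by (metis linear)
qed

text \<open>One choice of lifts suffices: any other choice has the same commutators, and the
  infinite order of \<open>kernel_gen\<close> makes the exponent unique.\<close>

lemma euler_class_eqI:
  assumes xy: "\<And>i. i < g \<Longrightarrow> x i \<in> carrier PSL_cover \<and> y i \<in> carrier PSL_cover"
    and lifts: "\<And>i. i < g \<Longrightarrow> cover_map (x i) = \<rho> (surf_a g i) \<and> cover_map (y i) = \<rho> (surf_b g i)"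
    and k: "commutator_product PSL_cover g x y = kernel_gen [^]\<^bsub>PSL_cover\<^esub> (k :: int)"
  shows "euler_class g \<rho> = k"
  unfolding euler_class_def
proof (rule the_equality)
  show "\<forall>x y. (\<forall>i<g. x i \<in> carrier PSL_cover \<and> cover_map (x i) = \<rho> (surf_a g i) \<and>
      y i \<in> carrier PSL_cover \<and> cover_map (y i) = \<rho> (surf_b g i)) \<longrightarrow>
    commutator_product PSL_cover g x y = kernel_gen [^]\<^bsub>PSL_cover\<^esub> k"
  proof (intro allI impI)
    fix x' y'
    assume "\<forall>i<g. x' i \<in> carrier PSL_cover \<and> cover_map (x' i) = \<rho> (surf_a g i) \<and>
      y' i \<in> carrier PSL_cover \<and> cover_map (y' i) = \<rho> (surf_b g i)"
    then have "commutator PSL_cover (x' i) (y' i) = commutator PSL_cover (x i) (y i)" if "i < g" for i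
      using that xy lifts unfolding PSL_cover_def by (intro PSL.commutator_cong_cover_map) auto
    then show "commutator_product PSL_cover g x' y' = kernel_gen [^]\<^bsub>PSL_cover\<^esub> k"
      unfolding k[symmetric] by (rule cover.commutator_product_cong)
  qed
next
  fix n :: int
  assume "\<forall>x y. (\<forall>i<g. x i \<in> carrier PSL_cover \<and> cover_map (x i) = \<rho> (surf_a g i) \<and>
      y i \<in> carrier PSL_cover \<and> cover_map (y i) = \<rho> (surf_b g i)) \<longrightarrow>
    commutator_product PSL_cover g x y = kernel_gen [^]\<^bsub>PSL_cover\<^esub> n"
  then have "commutator_product PSL_cover g x y = kernel_gen [^]\<^bsub>PSL_cover\<^esub> n"
    using xy lifts by blast
  then show "n = k" using k kernel_gen_int_pow_inj by simp
qed

section \<open>Representations of presented groups\<close>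

fun word_value :: "('b, 'c) monoid_scheme \<Rightarrow> ('a \<Rightarrow> 'b) \<Rightarrow> 'a word \<Rightarrow> 'b" where
  "word_value G f [] = \<one>\<^bsub>G\<^esub>"
| "word_value G f ((x, b) # w) = (if b then f x else inv\<^bsub>G\<^esub> (f x)) \<otimes>\<^bsub>G\<^esub> word_value G f w"

text \<open>For \<open>f\<close> with values in the group and relators that evaluate to the
  identity, \<open>word_value\<close> is constant on each class, so \<open>the_elem\<close> picks
  that value.\<close>

definition presented_hom :: "('b, 'c) monoid_scheme \<Rightarrow> ('a \<Rightarrow> 'b) \<Rightarrow> 'a word set \<Rightarrow> 'b" where
  "presented_hom G f X = the_elem (word_value G f ` X)"

context group
begin

lemma word_value_in_subgroup:
  assumes "subgroup H G" "f ` S \<subseteq> H" "w \<in> words S"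
  shows "word_value G f w \<in> H"
  using assms(3)
proof (induction w)
  case (Cons a w)
  then show ?case
    using assms(2) subgroup.m_closed[OF assms(1)] subgroup.m_inv_closed[OF assms(1)]
    by (cases a) (auto simp: image_subset_iff)
qed (simp add: subgroup.one_closed[OF assms(1)])

lemma word_value_closed: "f ` S \<subseteq> carrier G \<Longrightarrow> w \<in> words S \<Longrightarrow> word_value G f w \<in> carrier G"
  using word_value_in_subgroup[OF subgroup_self] .

lemma word_value_append:
  assumes "f ` S \<subseteq> carrier G" "v \<in> words S" "w \<in> words S"
  shows "word_value G f (v @ w) = word_value G f v \<otimes> word_value G f w"
  using assms(2)
proof (induction v)
  case (Cons a v)
  then show ?case
    using assms by (cases a) (auto simp: m_assoc image_subset_iff word_value_closed)
qed (simp add: word_value_closed[OF assms(1,3)])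

lemma word_value_eq:
  assumes f: "f ` S \<subseteq> carrier G" and R: "\<And>r. r \<in> R \<Longrightarrow> word_value G f r = \<one>"
    and "word_eq S R v w"
  shows "word_value G f v = word_value G f w"
  using assms(3)
proof (induction rule: word_eq.induct)
  case (cancel u v x b)
  then have "f x \<in> carrier G" using f by auto
  moreover have "word_value G f v \<in> carrier G" using cancel f by (intro word_value_closed)
  ultimately show ?case
    using cancel by (simp add: word_value_append[OF f] inv_mult_cancel_left)
next
  case (relator u v r)
  then show ?case by (simp add: word_value_append[OF f] R word_value_closed[OF f])
qed auto

lemma presented_hom_class:
  assumes f: "f ` S \<subseteq> carrier G" and R: "\<And>r. r \<in> R \<Longrightarrow> word_value G f r = \<one>"
    and w: "w \<in> words S"
  shows "presented_hom G f (word_rel S R `` {w}) = word_value G f w"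
proof -
  have "w \<in> word_rel S R `` {w}" using w by (simp add: word_rel_def word_eq.refl)
  moreover have "word_value G f v = word_value G f w" if "v \<in> word_rel S R `` {w}" for v
    using that word_value_eq[OF f R] by (auto simp: word_rel_def)
  ultimately have "word_value G f ` (word_rel S R `` {w}) = {word_value G f w}" by blast
  then show ?thesis by (simp add: presented_hom_def)
qed

lemma presented_hom_hom:
  assumes f: "f ` S \<subseteq> carrier G" and R: "\<And>r. r \<in> R \<Longrightarrow> word_value G f r = \<one>"
  shows "presented_hom G f \<in> hom (presented_group S R) G"
proof (rule homI)
  note class_val = presented_hom_class[OF f R]
  have car: "carrier (presented_group S R) = words S // word_rel S R"
    by (simp add: presented_group_def)
  show "presented_hom G f X \<in> carrier G" if "X \<in> carrier (presented_group S R)" for X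
    using that unfolding car by (auto elim!: quotientE simp: class_val word_value_closed[OF f])
  show "presented_hom G f (X \<otimes>\<^bsub>presented_group S R\<^esub> Y) = presented_hom G f X \<otimes> presented_hom G f Y"
    if "X \<in> carrier (presented_group S R)" "Y \<in> carrier (presented_group S R)" for X Y
    using that unfolding car
    by (auto elim!: quotientE simp: class_val presented_group_mult word_value_append[OF f])
qed

lemma presented_hom_gen_class:
  assumes f: "f ` S \<subseteq> carrier G" and R: "\<And>r. r \<in> R \<Longrightarrow> word_value G f r = \<one>" and "x \<in> S"
  shows "presented_hom G f (gen_class S R x) = f x"
  using assms presented_hom_class[OF f R, where w = "[(x, True)]"] by (auto simp: gen_class_def)

lemma presented_hom_image:
  assumes f: "f ` S \<subseteq> carrier G" and R: "\<And>r. r \<in> R \<Longrightarrow> word_value G f r = \<one>"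
    and H: "subgroup H G" "f ` S \<subseteq> H"
  shows "presented_hom G f ` carrier (presented_group S R) \<subseteq> H"
  using presented_hom_class[OF f R] word_value_in_subgroup[OF H]
  by (auto simp: presented_group_def elim!: quotientE)

lemma word_value_surface_relator:
  assumes "\<And>i. i < g \<Longrightarrow> f (GenA i) \<in> carrier G \<and> f (GenB i) \<in> carrier G"
  shows "word_value G f (surface_relator g) =
    commutator_product G g (\<lambda>i. f (GenA i)) (\<lambda>i. f (GenB i))"
proof -
  \<comment> \<open>An arbitrary index list replaces \<open>[0..<g]\<close>, so that the induction
    can remove its head.\<close>
  have "word_value G f (concat (map (\<lambda>i. [(GenA i, True), (GenB i, True), (GenA i, False), (GenB i, False)]) xs)) =
      foldr (\<otimes>) (map (\<lambda>i. commutator G (f (GenA i)) (f (GenB i))) xs) \<one>"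
    if "set xs \<subseteq> {..<g}" for xs
    using that
  proof (induction xs)
    case (Cons i xs)
    have "foldr (\<otimes>) (map (\<lambda>i. commutator G (f (GenA i)) (f (GenB i))) xs) \<one> \<in> carrier G"
      using Cons.prems assms by (intro foldr_mult_closed) auto
    then show ?case using Cons assms[of i] by (simp add: commutator_def m_assoc)
  qed simp
  then show ?thesis
    unfolding surface_relator_def commutator_product_def by (simp add: lessThan_atLeast0)
qed

end

section \<open>An arithmetic lattice\<close>

text \<open>With \<open>i\<^sup>2 = 7\<close>, \<open>j\<^sup>2 = -1\<close> and \<open>ij = -ji = k\<close>, the matrix \<open>even_mat a b c d\<close> represents
  \<open>a + b i + c j + d (1 + i + j + k) / 2\<close>. These elements form an order of a quaternion algebra
  over the rationals. The odd matrices are \<open>1 / sqrt 7\<close> times the elements of the two-sided ideal of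
  norm 7 in this order, whose square is generated by 7. Thus the even and the odd
  matrices together are closed under multiplication.\<close>

definition even_mat :: "int \<Rightarrow> int \<Rightarrow> int \<Rightarrow> int \<Rightarrow> real^2^2" where
  "even_mat a b c d = mat2
     ((of_int (2 * a + d) + of_int (2 * b + d) * sqrt 7) / 2) ((of_int (2 * c + d) + of_int d * sqrt 7) / 2)
     ((- of_int (2 * c + d) + of_int d * sqrt 7) / 2) ((of_int (2 * a + d) - of_int (2 * b + d) * sqrt 7) / 2)"

definition odd_mat :: "int \<Rightarrow> int \<Rightarrow> int \<Rightarrow> int \<Rightarrow> real^2^2" where
  "odd_mat a b c d = mat2
     ((of_int (2 * a + d) * sqrt 7 + of_int (2 * b + d)) / 2) ((of_int (2 * c + d) * sqrt 7 + of_int d) / 2)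
     ((- of_int (2 * c + d) * sqrt 7 + of_int d) / 2) ((of_int (2 * a + d) * sqrt 7 - of_int (2 * b + d)) / 2)"

text \<open>Multiplication in the basis 1, i, j, (1 + i + j + k) / 2. The point of this formula and
  the next three is that the new coordinates are integer polynomials in the old ones.\<close>

lemma even_even_mult:
  "even_mat a b c d ** even_mat a' b' c' d' = even_mat
    (a * a' + 7 * b * b' - b * c' + 3 * b * d' + c * b' - c * c' + 4 * d * b' - d * c' + 3 * d * d')
    (a * b' + b * a' - b * c' + c * b' + c * d' + d * b' - d * c')
    (a * c' - b * c' + 3 * b * d' + c * a' + c * b' + c * d' - 3 * d * b')
    (a * d' + 2 * b * c' + b * d' - 2 * c * b' - c * d' + d * a' - d * b' + d * c' + d * d')"
  by (simp add: even_mat_def odd_mat_def mat2_mult mat2_eq_iff field_simps sqrt7_mult_sqrt7)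

lemma even_odd_mult:
  "even_mat a b c d ** odd_mat a' b' c' d' = odd_mat
    (a * a' + b * b' - 7 * b * c' - 3 * b * d' + c * b' - c * c' - 3 * d * a' + d * b' - 4 * d * c' - 3 * d * d')
    (a * b' + 7 * b * a' - 7 * b * c' + c * b' + c * d' + d * b' - 7 * d * c' - 3 * d * d')
    (a * c' - 7 * b * c' - 3 * b * d' + c * a' + c * b' + c * d' - 3 * d * a' - 3 * d * c' - 3 * d * d')
    (a * d' + 14 * b * c' + 7 * b * d' - 2 * c * b' - c * d' + 7 * d * a' - d * b' + 7 * d * c' + 7 * d * d')"
  by (simp add: even_mat_def odd_mat_def mat2_mult mat2_eq_iff field_simps sqrt7_mult_sqrt7)

lemma odd_even_mult:
  "odd_mat a b c d ** even_mat a' b' c' d' = odd_mat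
    (a * a' - 3 * a * d' + b * b' - b * c' + 7 * c * b' - c * c' + 3 * c * d' + 4 * d * b' - d * c')
    (7 * a * b' + b * a' - b * c' + 7 * c * b' + 7 * c * d' + 7 * d * b' - d * c' + 3 * d * d')
    (a * c' - 3 * a * d' - b * c' + c * a' + 7 * c * b' + 4 * c * d' + 3 * d * b')
    (7 * a * d' + 2 * b * c' + b * d' - 14 * c * b' - 7 * c * d' + d * a' - 7 * d * b' + d * c' + d * d')"
  by (simp add: even_mat_def odd_mat_def mat2_mult mat2_eq_iff field_simps sqrt7_mult_sqrt7)

lemma odd_odd_mult:
  "odd_mat a b c d ** odd_mat a' b' c' d' = even_mat
    (7 * a * a' + 3 * a * d' + b * b' - b * c' + c * b' - 7 * c * c' - 3 * c * d' + 3 * d * a' + d * b' - 4 * d * c')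
    (a * b' + b * a' - b * c' + c * b' + c * d' + d * b' - d * c')
    (7 * a * c' + 3 * a * d' - b * c' + 7 * c * a' + c * b' + 4 * c * d' + 3 * d * a' + 3 * d * c' + 3 * d * d')
    (a * d' + 2 * b * c' + b * d' - 2 * c * b' - c * d' + d * a' - d * b' + d * c' + d * d')"
  by (simp add: even_mat_def odd_mat_def mat2_mult mat2_eq_iff field_simps sqrt7_mult_sqrt7)

definition even_mats :: "(real^2^2) set" where
  "even_mats = {A. \<exists>a b c d. A = even_mat a b c d}"

definition odd_mats :: "(real^2^2) set" where
  "odd_mats = {A. \<exists>a b c d. A = odd_mat a b c d}"

definition lattice_mats :: "(real^2^2) set" where
  "lattice_mats = carrier SL2R \<inter> (even_mats \<union> odd_mats)"

lemma lattice_mats_subset: "lattice_mats \<subseteq> carrier SL2R"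
  by (simp add: lattice_mats_def)

lemma even_mats_I: "even_mat a b c d \<in> even_mats"
  by (auto simp: even_mats_def)

lemma odd_mats_I: "odd_mat a b c d \<in> odd_mats"
  by (auto simp: odd_mats_def)

lemma lattice_matsE:
  assumes "A \<in> lattice_mats"
  obtains a b c d where "A = even_mat a b c d" | a b c d where "A = odd_mat a b c d"
  using assms by (auto simp: lattice_mats_def even_mats_def odd_mats_def)

lemma lattice_mats_mult:
  assumes A: "A \<in> lattice_mats" and B: "B \<in> lattice_mats"
  shows "A ** B \<in> lattice_mats"
proof -
  have "A ** B \<in> even_mats \<union> odd_mats"
    by (rule lattice_matsE[OF A]; rule lattice_matsE[OF B];
        simp only: even_even_mult even_odd_mult odd_even_mult odd_odd_mult even_mats_I odd_mats_I Un_iff simp_thms)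
  moreover have "A ** B \<in> carrier SL2R"
    using A B SL.m_closed[of A B] by (simp add: lattice_mats_def SL2R_mult)
  ultimately show ?thesis by (simp add: lattice_mats_def)
qed

lemma lattice_mats_inv:
  assumes "A \<in> lattice_mats" shows "inv\<^bsub>SL2R\<^esub> A \<in> lattice_mats"
proof -
  have A: "A \<in> carrier SL2R" using assms by (simp add: lattice_mats_def)
  have adj: "inv\<^bsub>SL2R\<^esub> A = mat2 (A $ 2 $ 2) (- A $ 1 $ 2) (- A $ 2 $ 1) (A $ 1 $ 1)"
    using SL2R_inv[OF A] by (simp add: mat2_def)
  have "inv\<^bsub>SL2R\<^esub> A \<in> even_mats \<union> odd_mats"
    using assms
  proof (cases rule: lattice_matsE)
    case (1 a b c d)
    \<comment> \<open>The adjugate is quaternion conjugation, which sends (1 + i + j + k) / 2 to 1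
      minus itself; hence the coordinate \<open>a + d\<close>.\<close>
    have "inv\<^bsub>SL2R\<^esub> A = even_mat (a + d) (- b) (- c) (- d)"
      unfolding adj unfolding 1 by (simp add: even_mat_def mat2_eq_iff field_simps)
    then show ?thesis using even_mats_I by simp
  next
    case (2 a b c d)
    have "inv\<^bsub>SL2R\<^esub> A = odd_mat (a + d) (- b) (- c) (- d)"
      unfolding adj unfolding 2 by (simp add: odd_mat_def mat2_eq_iff field_simps)
    then show ?thesis using odd_mats_I by simp
  qed
  then show ?thesis
    using SL.inv_closed[OF A] by (simp add: lattice_mats_def)
qed

lemma lattice_mats_uminus:
  assumes "A \<in> lattice_mats" shows "- A \<in> lattice_mats"
proof -
  have "- even_mat a b c d = even_mat (- a) (- b) (- c) (- d)"
    "- odd_mat a b c d = odd_mat (- a) (- b) (- c) (- d)" for a b c d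
    by (simp_all add: even_mat_def odd_mat_def mat2_uminus mat2_eq_iff field_simps)
  moreover have "- A \<in> carrier SL2R" using assms by (simp add: lattice_mats_def SL2R_def det_2)
  moreover have "- A \<in> even_mats \<union> odd_mats"
    by (rule lattice_matsE[OF assms]; simp only: calculation even_mats_I odd_mats_I Un_iff simp_thms)
  ultimately show ?thesis by (simp add: lattice_mats_def)
qed

lemma one_lattice_mats: "mat 1 \<in> lattice_mats"
proof -
  have "mat 1 = even_mat 1 0 0 0" by (simp add: even_mat_def mat2_one)
  then have "mat 1 \<in> even_mats" using even_mats_I by metis
  moreover have "mat 1 \<in> carrier SL2R" using SL.one_closed by (simp add: SL2R_def)
  ultimately show ?thesis by (simp add: lattice_mats_def)
qed

lemma gen_lattice_mats: "gen_p \<in> lattice_mats" "gen_b \<in> lattice_mats"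
proof -
  \<comment> \<open>Both traces are sqrt 7, which points to odd matrices; the coordinates come from
    sums and differences of opposite entries.\<close>
  have "gen_p = odd_mat 0 1 0 1" "gen_b = odd_mat 0 (-2) (-1) 1"
    by (simp_all add: gen_p_def gen_b_def odd_mat_def mat2_eq_iff field_simps)
  then have "gen_p \<in> odd_mats" "gen_b \<in> odd_mats" using odd_mats_I by metis+
  then show "gen_p \<in> lattice_mats" "gen_b \<in> lattice_mats"
    using gen_SL2R by (simp_all add: lattice_mats_def)
qed

section \<open>Discreteness of the lattice and its subgroups\<close>

definition lattice_group :: "(real^2^2) set set" where
  "lattice_group = PSL_proj ` lattice_mats"

lemma subgroup_lattice_group: "subgroup lattice_group PSL2R"
proof (rule PSL.subgroupI)
  show "lattice_group \<subseteq> carrier PSL2R"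
    using lattice_mats_subset by (auto simp: lattice_group_def carrier_PSL2R)
  show "lattice_group \<noteq> {}" using one_lattice_mats by (auto simp: lattice_group_def)
  show "inv\<^bsub>PSL2R\<^esub> X \<in> lattice_group" if "X \<in> lattice_group" for X
    using that lattice_mats_subset lattice_mats_inv by (auto simp: lattice_group_def PSL_proj_inv)
  show "X \<otimes>\<^bsub>PSL2R\<^esub> Y \<in> lattice_group" if "X \<in> lattice_group" "Y \<in> lattice_group" for X Y
    using that lattice_mats_subset lattice_mats_mult by (auto simp: lattice_group_def PSL_proj_mult subset_iff)
qed

text \<open>The entries lie in half of \<int>[sqrt 7], which is dense in \<real>. But up to sign the
  two diagonal entries are Galois conjugate, and so are the two others; a bound on the matrix bounds
  both conjugates and leaves finitely many coordinates.\<close>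

lemma finite_bounded_lattice_mats: "finite {A \<in> lattice_mats. \<forall>i j. \<bar>A $ i $ j\<bar> \<le> K}"
proof -
  define N where "N = \<lceil>2 * K\<rceil>"
  let ?B = "{- N..N} \<times> {- N..N} \<times> {- N..N} \<times> {- N..N}"
  have abs_le: "\<bar>m\<bar> \<le> N" if "\<bar>of_int m * sqrt 7\<bar> \<le> 2 * K \<or> \<bar>of_int m\<bar> \<le> 2 * K" for m :: int
  proof -
    have "\<bar>of_int m\<bar> * 1 \<le> \<bar>of_int m\<bar> * sqrt 7" by (intro mult_left_mono) auto
    then have "of_int \<bar>m\<bar> \<le> 2 * K" using that by (auto simp: abs_mult)
    then show ?thesis by (simp add: N_def le_ceiling_iff)
  qed
  have "A \<in> (\<lambda>(a, b, c, d). even_mat a b c d) ` ?B \<union> (\<lambda>(a, b, c, d). odd_mat a b c d) ` ?B"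
    if A: "A \<in> lattice_mats" and K: "\<And>i j. \<bar>A $ i $ j\<bar> \<le> K" for A
  proof -
    have K': "\<bar>A $ i $ j + A $ k $ l\<bar> \<le> 2 * K" "\<bar>A $ i $ j - A $ k $ l\<bar> \<le> 2 * K" for i j k l
      using K[of i j] K[of k l] by linarith+
    from A show ?thesis
    proof (cases rule: lattice_matsE)
      case A: (1 a b c d)
      have sums: "A $ 1 $ 1 + A $ 2 $ 2 = of_int (2 * a + d)" "A $ 1 $ 1 - A $ 2 $ 2 = of_int (2 * b + d) * sqrt 7"
        "A $ 1 $ 2 - A $ 2 $ 1 = of_int (2 * c + d)" "A $ 1 $ 2 + A $ 2 $ 1 = of_int d * sqrt 7"
        by (simp_all add: A even_mat_def field_simps)
      have "\<bar>2 * a + d\<bar> \<le> N" "\<bar>2 * b + d\<bar> \<le> N" "\<bar>2 * c + d\<bar> \<le> N" "\<bar>d\<bar> \<le> N"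
        using abs_le K'(1)[of 1 1 2 2] K'(2)[of 1 1 2 2] K'(2)[of 1 2 2 1] K'(1)[of 1 2 2 1]
        unfolding sums by blast+
      \<comment> \<open>The bounds on 2a + d and on d together bound a by \<open>N\<close>, and
        likewise b and c.\<close>
      then have "(a, b, c, d) \<in> ?B" by auto
      then have "even_mat a b c d \<in> (\<lambda>(a, b, c, d). even_mat a b c d) ` ?B"
        by (intro image_eqI[where x = "(a, b, c, d)"]) simp_all
      then show ?thesis unfolding A by (rule UnI1)
    next
      case A: (2 a b c d)
      have sums: "A $ 1 $ 1 + A $ 2 $ 2 = of_int (2 * a + d) * sqrt 7" "A $ 1 $ 1 - A $ 2 $ 2 = of_int (2 * b + d)"
        "A $ 1 $ 2 - A $ 2 $ 1 = of_int (2 * c + d) * sqrt 7" "A $ 1 $ 2 + A $ 2 $ 1 = of_int d"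
        by (simp_all add: A odd_mat_def field_simps)
      have "\<bar>2 * a + d\<bar> \<le> N" "\<bar>2 * b + d\<bar> \<le> N" "\<bar>2 * c + d\<bar> \<le> N" "\<bar>d\<bar> \<le> N"
        using abs_le K'(1)[of 1 1 2 2] K'(2)[of 1 1 2 2] K'(2)[of 1 2 2 1] K'(1)[of 1 2 2 1]
        unfolding sums by blast+
      then have "(a, b, c, d) \<in> ?B" by auto
      then have "odd_mat a b c d \<in> (\<lambda>(a, b, c, d). odd_mat a b c d) ` ?B"
        by (intro image_eqI[where x = "(a, b, c, d)"]) simp_all
      then show ?thesis unfolding A by (rule UnI2)
    qed
  qed
  then have "{A \<in> lattice_mats. \<forall>i j. \<bar>A $ i $ j\<bar> \<le> K} \<subseteq>
      (\<lambda>(a, b, c, d). even_mat a b c d) ` ?B \<union> (\<lambda>(a, b, c, d). odd_mat a b c d) ` ?B"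
    by blast
  then show ?thesis by (rule finite_subset) auto
qed

text \<open>Within distance 1 of any matrix \<open>A\<close> the entries are bounded, so only
  finitely many lattice matrices have to be avoided.\<close>

lemma lattice_mats_isolated:
  obtains e where "e > 0" "\<And>B. B \<in> lattice_mats \<Longrightarrow> dist A B < e \<Longrightarrow> B = A"
proof -
  let ?S = "{B \<in> lattice_mats. \<forall>i j. \<bar>B $ i $ j\<bar> \<le> norm A + 1}"
  obtain e where e: "e > 0" "\<And>B. B \<in> ?S \<Longrightarrow> B \<noteq> A \<Longrightarrow> e \<le> dist A B"
    using finite_set_avoid[OF finite_bounded_lattice_mats[of "norm A + 1"], of A] by blast
  show ?thesis
  proof
    show "min e 1 > 0" using e by simp
    fix B assume B: "B \<in> lattice_mats" "dist A B < min e 1"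
    have "\<bar>B $ i $ j\<bar> \<le> norm A + 1" for i j
    proof -
      have "\<bar>B $ i $ j\<bar> \<le> norm B"
        using component_le_norm_cart[of "B $ i" j] Finite_Cartesian_Product.norm_nth_le[of B i] by simp
      also have "norm B \<le> norm A + dist A B"
        using norm_triangle_ineq[of A "B - A"] by (simp add: dist_norm norm_minus_commute)
      finally show ?thesis using B by simp
    qed
    with B e(2)[of B] show "B = A" by (cases "B = A") auto
  qed
qed

text \<open>Stated for every subgroup, as the image of a representation may be a proper part of the
  lattice.\<close>

lemma discrete_subgroup_lattice:
  assumes H: "subgroup H PSL2R" "H \<subseteq> lattice_group"
  shows "discrete_subgroup PSL2R PSL_topology H"
proof -
  have HC: "H \<subseteq> carrier PSL2R" using H(1) by (rule subgroup.subset)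
  have "openin (subtopology PSL_topology H) {X}" if X: "X \<in> H" for X
  proof -
    obtain A where A: "A \<in> lattice_mats" "X = PSL_proj A"
      using X H(2) by (auto simp: lattice_group_def)
    obtain e where e: "e > 0" "\<And>B. B \<in> lattice_mats \<Longrightarrow> dist A B < e \<Longrightarrow> B = A"
      using lattice_mats_isolated by metis
    let ?V = "PSL_proj ` (carrier SL2R \<inter> ball A e)"
    have "openin PSL_topology ?V"
      using open_map_PSL_proj by (auto simp: open_map_def openin_open_Int)
    moreover have "?V \<inter> H = {X}"
    proof (intro equalityI subsetI)
      fix Y assume Y: "Y \<in> ?V \<inter> H"
      then obtain B C where B: "dist A B < e" "Y = PSL_proj B" and C: "C \<in> lattice_mats" "Y = PSL_proj C"
        using H(2) by (auto simp: lattice_group_def)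
      \<comment> \<open>A coset has two members, so the matrix \<open>B\<close> from the ball equals
        the lattice matrix \<open>C\<close> up to sign. It therefore lies in the lattice, and
        isolation gives \<open>B = A\<close>.\<close>
      then have "B = C \<or> B = - C" by (auto simp: PSL_proj_eq doubleton_eq_iff)
      then have "B \<in> lattice_mats" using C lattice_mats_uminus by auto
      then show "Y \<in> {X}" using e B A by auto
    qed (use A X e lattice_mats_subset in auto)
    ultimately show ?thesis unfolding openin_subtopology by blast
  qed
  then have "subtopology PSL_topology H = discrete_topology H"
    using HC by (metis discrete_topology_unique topspace_PSL_topology topspace_subtopology_subset)
  with H(1) show ?thesis by (simp add: discrete_subgroup_def)
qed

section \<open>The representation\<close>

context group_hom
begin

lemma hom_commutator:
  "x \<in> carrier G \<Longrightarrow> y \<in> carrier G \<Longrightarrow> h (commutator G x y) = commutator H (h x) (h y)"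
  by (simp add: commutator_def)

lemma hom_commutator_product:
  assumes "\<And>i. i < n \<Longrightarrow> x i \<in> carrier G \<and> y i \<in> carrier G"
  shows "h (commutator_product G n x y) = commutator_product H n (\<lambda>i. h (x i)) (\<lambda>i. h (y i))"
proof -
  have "h (foldr (\<otimes>\<^bsub>G\<^esub>) (map (\<lambda>i. commutator G (x i) (y i)) is) \<one>\<^bsub>G\<^esub>) =
      foldr (\<otimes>\<^bsub>H\<^esub>) (map (\<lambda>i. commutator H (h (x i)) (h (y i))) is) \<one>\<^bsub>H\<^esub>"
    if "set is \<subseteq> {..<n}" for "is"
    using that
  proof (induction "is")
    case (Cons i "is")
    have "foldr (\<otimes>\<^bsub>G\<^esub>) (map (\<lambda>i. commutator G (x i) (y i)) is) \<one>\<^bsub>G\<^esub> \<in> carrier G"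
      using Cons.prems assms by (intro G.foldr_mult_closed) auto
    then show ?case using Cons assms[of i] by (simp add: hom_commutator G.commutator_closed)
  qed simp
  then show ?thesis unfolding commutator_product_def by (simp add: lessThan_atLeast0)
qed

lemma subgroup_hom_preimage:
  assumes "subgroup K H" shows "subgroup {x \<in> carrier G. h x \<in> K} G"
  using subgroup.one_closed[OF assms] subgroup.m_closed[OF assms] subgroup.m_inv_closed[OF assms]
  by (intro G.subgroupI) auto

end

theorem theorem1p3:
  fixes g :: nat and k :: int
  assumes "g \<ge> 2" and "\<bar>k\<bar> \<le> 2 * int g - 2"
  shows "\<exists>\<rho> \<in> hom (surface_group g) PSL2R.
    discrete_subgroup PSL2R PSL_topology (\<rho> ` carrier (surface_group g)) \<and>
    euler_class g \<rho> = k"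
proof -
  interpret lift: group_hom PSL_cover PSL2R cover_map
    by (intro group_hom.intro group_hom_axioms.intro group_PSL_cover group_PSL2R)
      (simp add: PSL_cover_def PSL.cover_map_hom)
  \<comment> \<open>Taking all commutators among lifts that lie over the lattice makes the
    representation take values in a discrete group.\<close>
  define H where "H = {X \<in> carrier PSL_cover. cover_map X \<in> lattice_group}"
  have H: "subgroup H PSL_cover"
    unfolding H_def by (rule lift.subgroup_hom_preimage[OF subgroup_lattice_group])
  have path: "SL_segment A \<in> SL_paths" if "A \<in> {gen_p, gen_b}" for A
    using that gen_SL2R gen_trace by (auto intro!: SL_segment_SL_path)
  have gen_H: "PSL_class (SL_segment A) \<in> H" if "A \<in> {gen_p, gen_b}" for A
    using path[OF that] gen_lattice_mats that
    by (auto simp: H_def PSL_class_closed cover_map_PSL_class SL_segment_1 lattice_group_def)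
  have "kernel_gen [^]\<^bsub>PSL_cover\<^esub> k \<in> commutator_products PSL_cover H g"
    using gen_H kernel_gen_central assms
    by (intro cover.central_pow_in_commutator_products[OF H _ _ gen_cover_commutator_square]) auto
  then obtain x y where xy: "\<And>i. i < g \<Longrightarrow> x i \<in> H \<and> y i \<in> H"
      and k: "commutator_product PSL_cover g x y = kernel_gen [^]\<^bsub>PSL_cover\<^esub> k"
    unfolding commutator_products_def by auto
  have xyC: "x i \<in> carrier PSL_cover \<and> y i \<in> carrier PSL_cover" if "i < g" for i
    using xy[OF that] by (simp add: H_def)
  define f where "f s = (case s of GenA i \<Rightarrow> cover_map (x i) | GenB i \<Rightarrow> cover_map (y i))" for s
  have fL: "f ` surface_gens g \<subseteq> lattice_group"
    using xy by (auto simp: surface_gens_def f_def H_def)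
  then have fC: "f ` surface_gens g \<subseteq> carrier PSL2R"
    using subgroup.subset[OF subgroup_lattice_group] by blast
  \<comment> \<open>The relator evaluates to the projection of a power of \<open>kernel_gen\<close>,
    which is trivial, so the assignment on generators descends to the surface group.\<close>
  have "word_value PSL2R f (surface_relator g) = commutator_product PSL2R g (\<lambda>i. cover_map (x i)) (\<lambda>i. cover_map (y i))"
    using PSL.word_value_surface_relator[of g f] xyC by (simp add: f_def)
  also have "\<dots> = cover_map (kernel_gen [^]\<^bsub>PSL_cover\<^esub> k)"
    using lift.hom_commutator_product[of g x y] xyC k by simp
  also have "\<dots> = \<one>\<^bsub>PSL2R\<^esub>"
    using kernel_gen_kernel by (simp add: lift.hom_int_pow PSL.int_pow_one)
  finally have R: "word_value PSL2R f r = \<one>\<^bsub>PSL2R\<^esub>" if "r \<in> {surface_relator g}" for r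
    using that by simp
  define \<rho> where "\<rho> = presented_hom PSL2R f"
  have hom: "\<rho> \<in> hom (surface_group g) PSL2R"
    unfolding \<rho>_def surface_group_def by (rule PSL.presented_hom_hom[OF fC R])
  interpret rho: group_hom "surface_group g" PSL2R \<rho>
    by (intro group_hom.intro group_hom_axioms.intro group_surface_group group_PSL2R hom)
  have "\<rho> ` carrier (surface_group g) \<subseteq> lattice_group"
    unfolding \<rho>_def surface_group_def
    by (rule PSL.presented_hom_image[OF fC R subgroup_lattice_group fL])
  then have "discrete_subgroup PSL2R PSL_topology (\<rho> ` carrier (surface_group g))"
    using rho.img_is_subgroup by (intro discrete_subgroup_lattice)
  \<comment> \<open>The elements \<open>x i\<close> and \<open>y i\<close> are themselves lifts of
    the images of the generators, and their commutator product is the k-th power by choice.\<close>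
  moreover have "euler_class g \<rho> = k"
  proof (rule euler_class_eqI[OF xyC _ k])
    fix i assume "i < g"
    then have "GenA i \<in> surface_gens g" "GenB i \<in> surface_gens g"
      by (simp_all add: surface_gens_def)
    moreover have "presented_hom PSL2R f (gen_class (surface_gens g) {surface_relator g} s) = f s"
      if "s \<in> surface_gens g" for s
      by (intro PSL.presented_hom_gen_class fC R that)
    ultimately show "cover_map (x i) = \<rho> (surf_a g i) \<and> cover_map (y i) = \<rho> (surf_b g i)"
      by (simp add: \<rho>_def surf_a_def surf_b_def f_def)
  qed
  ultimately show ?thesis using hom by blast
qed

end
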